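(* Let $G$ be a finitely generated group with word-length $|\cdot|$ and polynomial volume growth of degree $D$. Let $\ell:[0,\infty)\to[0,\infty)$ be a positive continuous increasing function which is slowly varying at infinity and satisfies $\int_1^\infty\frac{dt}{t\ell(t)}<\infty$. Set $$\theta(s)=\frac{1}{\int_0^{1/s}\frac{dt}{t\ell(1/t)}},\qquad \theta_2(s)=\tfrac12\theta(s^2).$$ Let $\varphi$ be a symmetric probability measure on $G$ such that $$\varphi(g)\simeq\frac{1}{(1+|g|)^D\ell(1+|g|^2)},$$ i.e. the ratio of the two sides is bounded above and below by positive constants uniformly in $g\in G$. Then $$\widetilde{\Phi}_{G,\theta_2}(n)\simeq\varphi^{(n)}(e).$$
   Context: Word length and growth: $G$ is equipped with a finite generating tuple $S=(s_1,\dots,s_k)$, and $S^*=\{e,s_1^{\pm1},\dots,s_k^{\pm1}\}$. For $g\in G$, $|g|$ is the least integer $m$ such that $g=\sigma_1\cdots\sigma_m$ with $\sigma_i\in S^*$ (and $|e|=0$). $G$ has polynomial volume growth of degree $D$ if $V(n)=\#\{g\in G:|g|\le n\}\simeq n^D$. Relation $\simeq$ (for functions of $n$): $f_1\simeq f_2$ means that there exist $c_1,c_2,c_3,c_4\in(0,\infty)$ such that $c_1f_1(c_2t)\le f_2(t)\le c_3f_1(c_4t)$ on the domain of definition. Here the comparison is for integers $n\ge1$; for functions defined only on $\mathbb N$, the rescaled arguments $c_2t$, $c_4t$ are rounded to integers ($\lceil c_2t\rceil$ and $\lfloor c_4t\rfloor$ respectively). Weak moments: for a function $\rho:[0,\infty)\to[0,\infty)$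 and a probability measure $\mu$ on $G$, set $W(\rho,\mu)=\sup_{s>0}\{s\,\mu(\{g:\rho(|g|)>s\})\}$. Let $\widetilde{\mathcal S}_{G,\rho}$ be the set of all symmetric probability measures $\phi$ on $G$ (i.e. $\phi(g)=\phi(g^{-1})$) with $W(\rho,\phi)\le2$, and $$\widetilde{\Phi}_{G,\rho}(n)=\inf\{\phi^{(2n)}(e):\phi\in\widetilde{\mathcal S}_{G,\rho}\},$$ where $\phi^{(m)}$ is the $m$-fold convolution power of $\phi$ (and $\phi^{(0)}=\delta_e$). By convention $\theta(0)=\theta_2(0)=0$ (the integral defining $\theta$ diverges as $s\to0$). *)

theory Defs
  imports "HOL-Probability.Probability" "HOL-Algebra.Generated_Groups"
begin

definition gen_tuple :: "('a, 'b) monoid_scheme \<Rightarrow> 'a list \<Rightarrow> bool" where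
  "gen_tuple G S \<longleftrightarrow> set S \<subseteq> carrier G \<and> generate G (set S) = carrier G"

definition sym_gens :: "('a, 'b) monoid_scheme \<Rightarrow> 'a list \<Rightarrow> 'a set" where
  "sym_gens G S = {\<one>\<^bsub>G\<^esub>} \<union> set S \<union> (\<lambda>s. inv\<^bsub>G\<^esub> s) ` set S"

definition word_length :: "('a, 'b) monoid_scheme \<Rightarrow> 'a list \<Rightarrow> 'a \<Rightarrow> nat" where
  "word_length G S g =
     (LEAST m. \<exists>w. length w = m \<and> set w \<subseteq> sym_gens G S \<and>
                   g = foldr (\<lambda>x y. x \<otimes>\<^bsub>G\<^esub> y) w \<one>\<^bsub>G\<^esub>)"

definition volume :: "('a, 'b) monoid_scheme \<Rightarrow> 'a list \<Rightarrow> nat \<Rightarrow> nat" where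
  "volume G S n = card {g \<in> carrier G. word_length G S g \<le> n}"

text \<open>The relation \<open>f\<^sub>1 \<simeq> f\<^sub>2\<close> for functions on the naturals, compared at integers \<open>n \<ge> 1\<close>;
  rescaled arguments are rounded up in the lower bound and down in the upper bound.\<close>
definition sim_nat :: "(nat \<Rightarrow> real) \<Rightarrow> (nat \<Rightarrow> real) \<Rightarrow> bool" where
  "sim_nat f1 f2 \<longleftrightarrow>
     (\<exists>c1 c2 c3 c4 :: real. c1 > 0 \<and> c2 > 0 \<and> c3 > 0 \<and> c4 > 0 \<and>
        (\<forall>n\<ge>1. c1 * f1 (nat \<lceil>c2 * real n\<rceil>) \<le> f2 n \<and>
                f2 n \<le> c3 * f1 (nat \<lfloor>c4 * real n\<rfloor>)))"

definition poly_growth :: "('a, 'b) monoid_scheme \<Rightarrow> 'a list \<Rightarrow> real \<Rightarrow> bool" where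
  "poly_growth G S D \<longleftrightarrow> sim_nat (\<lambda>n. real (volume G S n)) (\<lambda>n. real n powr D)"

definition slowly_varying :: "(real \<Rightarrow> real) \<Rightarrow> bool" where
  "slowly_varying l \<longleftrightarrow> (\<forall>c>0. ((\<lambda>t. l (c * t) / l t) \<longlongrightarrow> 1) at_top)"

text \<open>The integral diverges as \<open>s\<close> tends to \<open>0\<close>, whence the convention \<open>\<theta>(0) = 0\<close>.\<close>
definition theta :: "(real \<Rightarrow> real) \<Rightarrow> real \<Rightarrow> real" where
  "theta l s = (if s = 0 then 0 else 1 / (LINT t:{0<..1/s}|lborel. 1 / (t * l (1 / t))))"

definition theta2 :: "(real \<Rightarrow> real) \<Rightarrow> real \<Rightarrow> real" where
  "theta2 l s = (1/2) * theta l (s\<^sup>2)"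

text \<open>A probability measure on the (countable) group \<open>G\<close> is a \<open>pmf\<close> supported in \<open>carrier G\<close>.\<close>
definition prob_on :: "('a, 'b) monoid_scheme \<Rightarrow> 'a pmf \<Rightarrow> bool" where
  "prob_on G \<mu> \<longleftrightarrow> set_pmf \<mu> \<subseteq> carrier G"

definition symmetric_on :: "('a, 'b) monoid_scheme \<Rightarrow> 'a pmf \<Rightarrow> bool" where
  "symmetric_on G \<mu> \<longleftrightarrow> (\<forall>g\<in>carrier G. pmf \<mu> g = pmf \<mu> (inv\<^bsub>G\<^esub> g))"

text \<open>The convolution of two measures is the law of the product of independent samples.\<close>
definition conv :: "('a, 'b) monoid_scheme \<Rightarrow> 'a pmf \<Rightarrow> 'a pmf \<Rightarrow> 'a pmf" where
  "conv G \<mu> \<nu> = map_pmf (\<lambda>(x, y). x \<otimes>\<^bsub>G\<^esub> y) (pair_pmf \<mu> \<nu>)"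

primrec conv_power :: "('a, 'b) monoid_scheme \<Rightarrow> 'a pmf \<Rightarrow> nat \<Rightarrow> 'a pmf" where
  "conv_power G \<mu> 0 = return_pmf \<one>\<^bsub>G\<^esub>"
| "conv_power G \<mu> (Suc n) = conv G (conv_power G \<mu> n) \<mu>"

definition weak_moment ::
  "('a, 'b) monoid_scheme \<Rightarrow> 'a list \<Rightarrow> (real \<Rightarrow> real) \<Rightarrow> 'a pmf \<Rightarrow> ennreal" where
  "weak_moment G S \<rho> \<mu> =
     (SUP s\<in>{0<..}. ennreal s *
        emeasure (measure_pmf \<mu>) {g \<in> carrier G. \<rho> (real (word_length G S g)) > s})"

definition weak_class ::
  "('a, 'b) monoid_scheme \<Rightarrow> 'a list \<Rightarrow> (real \<Rightarrow> real) \<Rightarrow> 'a pmf set" where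
  "weak_class G S \<rho> =
     {\<phi>. prob_on G \<phi> \<and> symmetric_on G \<phi> \<and> weak_moment G S \<rho> \<phi> \<le> 2}"

definition weak_Phi ::
  "('a, 'b) monoid_scheme \<Rightarrow> 'a list \<Rightarrow> (real \<Rightarrow> real) \<Rightarrow> nat \<Rightarrow> real" where
  "weak_Phi G S \<rho> n =
     (INF \<phi>\<in>weak_class G S \<rho>. pmf (conv_power G \<phi> (2 * n)) \<one>\<^bsub>G\<^esub>)"

end

theory Submission
  imports Defs "HOL-Real_Asymp.Real_Asymp"
begin

text \<open>
  Write \<open>\<lambda>\<^sub>j = 1 / l(4\<^sup>j)\<close> and let \<open>h\<^sub>k\<close> be the sum of the \<open>\<lambda>\<^sub>j\<close> over \<open>j \<ge> k\<close>; up to constants this is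
  \<open>1 / \<theta>(4\<^sup>k)\<close>, and the weak moment condition on \<open>\<psi>\<close> says that \<open>\<psi>(|g| \<ge> 2\<^sup>k)\<close> is at most a constant
  times \<open>h\<^sub>k\<close>. Both sides of the comparison then turn out to be governed by
  \<open>sup\<^sub>k exp(- c n h\<^sub>k) 2\<^sup>-\<^sup>k\<^sup>D\<close>.

  Lower bound for \<open>\<psi>\<close>: test the Dirichlet form on the tent function of the ball of radius \<open>2\<^sup>k\<close>. Slow
  variation makes the truncated second moment of \<open>\<psi>\<close> comparable to \<open>4\<^sup>k h\<^sub>k\<close>, so the Rayleigh quotient
  is at least \<open>1 - C h\<^sub>k\<close>; log-convexity of the even moments of the quadratic form and the maximality
  of \<open>\<psi>\<^sup>(\<^sup>2\<^sup>n\<^sup>)\<close> at the identity give \<open>\<psi>\<^sup>(\<^sup>2\<^sup>n\<^sup>)(e) \<ge> (1 - C h\<^sub>k)\<^sup>2\<^sup>n / V(2\<^sup>k)\<close>.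

  Upper bound for \<open>\<phi>\<close>: \<open>\<phi>\<close> dominates a sum of uniform measures on the balls of radius \<open>2\<^sup>j\<close> with
  masses comparable to \<open>\<lambda>\<^sub>j\<close>. If \<open>k\<close> is the largest index used in \<open>n\<close> steps, then the
  product contains a factor bounded by \<open>1 / V(2\<^sup>k)\<close>, and the largest index is at most \<open>k\<close> with
  probability at most \<open>exp(- c n h\<^sub>k\<^sub>+\<^sub>1)\<close>.

  Since \<open>\<phi>\<close> itself need not satisfy the weak moment condition with constant \<open>2\<close>, the bound of the
  infimum from above uses a lazy version of \<open>\<phi>\<close>, again compared with \<open>\<phi>\<close> through these two bounds.
\<close>

section \<open>Slowly varying weights on dyadic scales\<close>

lemma sum_geometric_le:
  fixes q :: real
  assumes "0 \<le> q" "q < 1"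
  shows "(\<Sum>j\<in>{i..<K}. q ^ j) \<le> q ^ i / (1 - q)"
proof (cases "i \<le> K")
  case True
  have "(1 - q) * (\<Sum>j\<in>{i..<K}. q ^ j) = q ^ i - q ^ K"
    using True
  proof (induction K rule: dec_induct)
    case (step n)
    then show ?case by (simp add: distrib_left) (simp add: algebra_simps)
  qed simp
  also have "\<dots> \<le> q ^ i"
    using assms by simp
  finally show ?thesis
    using assms by (simp add: field_simps)
next
  case False
  then show ?thesis using assms by simp
qed

lemma sum_lessThan_reflect_geometric_le:
  fixes q :: real
  assumes "0 \<le> q" "q < 1"
  shows "(\<Sum>k<m. q ^ (m - k)) \<le> 1 / (1 - q)"
proof -
  have "(\<Sum>k<m. q ^ (m - k)) = (\<Sum>k<m. q ^ Suc k)"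
    by (rule sum.reindex_bij_witness[where i = "\<lambda>k. m - Suc k" and j = "\<lambda>k. m - Suc k"])
       (auto simp: Suc_diff_Suc)
  also have "\<dots> \<le> (\<Sum>k\<in>{0..<m}. q ^ k)"
    using assms by (auto simp: atLeast0LessThan mult_left_le_one_le intro!: sum_mono)
  also have "\<dots> \<le> 1 / (1 - q)"
    using sum_geometric_le[OF assms, of 0 m] by simp
  finally show ?thesis .
qed

text \<open>The terms \<open>exp (- x h\<^sub>k) q\<^sup>k\<close> increase at least geometrically before, and decrease geometrically
  after, the first index at which \<open>x (h\<^sub>k - h\<^sub>k\<^sub>+\<^sub>1)\<close> is small; hence no factor counting the
  terms is lost.\<close>
lemma sum_exp_power_le_sup:
  fixes h :: "nat \<Rightarrow> real" and q :: real
  assumes q: "0 < q" "q < 1"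
    and x: "0 \<le> x"
    and h0: "h \<longlonglongrightarrow> 0"
    and mono: "decseq h"
    and conv: "decseq (\<lambda>k. h k - h (Suc k))"
    and U: "\<And>k. exp (- x * h k) * q ^ k \<le> U"
  shows "(\<Sum>k\<le>K. exp (- 2 * x * h k) * q ^ k) \<le> 2 / (1 - q powr (1/4)) * U"
proof -
  define d where "d = - ln q"
  \<comment> \<open>The decay ratio on both sides of the turning index \<open>m\<close>, the first
    index at which \<open>x * lam\<close> falls below \<open>d / 4\<close>; such an index exists
    because \<open>lam\<close> tends to 0.\<close>
  define w where "w = exp (- d / 4)"
  have d: "d > 0" and qd: "q = exp (- d)"
    using q by (auto simp: d_def)
  have w: "0 < w" "w < 1" and w_eq: "w = q powr (1/4)"
    using d q by (auto simp: w_def powr_def d_def)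
  have hpos: "0 \<le> h k" for k
    using decseq_ge[OF mono h0] .
  define lam where "lam k = h k - h (Suc k)" for k
  have "lam \<longlonglongrightarrow> 0"
    unfolding lam_def using tendsto_diff[OF h0 LIMSEQ_Suc[OF h0]] by simp
  then have "(\<lambda>k. x * lam k) \<longlonglongrightarrow> x * 0"
    by (intro tendsto_intros)
  then have "eventually (\<lambda>k. x * lam k < d / 4) sequentially"
    using d order_tendstoD(2)[of "\<lambda>k. x * lam k" 0 sequentially "d / 4"] by simp
  then have ex: "\<exists>k. x * lam k < d / 4"
    by (auto simp: eventually_sequentially)
  define m where "m = (LEAST k. x * lam k < d / 4)"
  have m1: "x * lam m < d / 4"
    unfolding m_def by (rule LeastI_ex[OF ex])
  have m2: "x * lam k \<ge> d / 4" if "k < m" for k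
    using not_less_Least[of k "\<lambda>k. x * lam k < d / 4"] that by (auto simp: m_def)
  have Upos: "0 \<le> U"
    using U[of 0] by (simp add: order_trans[OF exp_ge_zero])
  \<comment> \<open>Split \<open>exp (- 2 * x * h k)\<close> into two equal factors. One is spent,
    together with \<open>q ^ k\<close>, on \<open>U\<close>; the other is at most
    \<open>w ^ (m - k)\<close>, because \<open>x * h\<close> drops by at least \<open>d / 4\<close>
    at each step up to \<open>m\<close>.\<close>
  have low: "exp (- 2 * x * h k) * q ^ k \<le> U * w ^ (m - k)" if "k < m" for k
  proof -
    have "x * h k \<ge> x * h m + d / 4 * real (m - k)"
    proof -
      have "x * (h (m - i) - h m) \<ge> d / 4 * real i" if "i \<le> m" for i
        using that
      proof (induction i)
        case (Suc i)
        have "Suc (m - Suc i) = m - i" using Suc.prems by simp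
        then have "x * (h (m - Suc i) - h (m - i)) \<ge> d / 4"
          using m2[of "m - Suc i"] Suc.prems by (simp add: lam_def)
        then show ?case using Suc by (simp add: algebra_simps add_divide_distrib)
      qed simp
      from this[of "m - k"] that show ?thesis by (simp add: algebra_simps)
    qed
    then have "x * h k \<ge> d / 4 * real (m - k)"
      using mult_nonneg_nonneg[OF x hpos[of m]] by linarith
    then have "exp (- x * h k) \<le> exp (- (d / 4 * real (m - k)))"
      by simp
    also have "\<dots> = w ^ (m - k)"
      by (simp add: w_def mult.commute flip: exp_of_nat_mult)
    finally have *: "exp (- x * h k) \<le> w ^ (m - k)" .
    have "exp (- 2 * x * h k) * q ^ k = exp (- x * h k) * q ^ k * exp (- x * h k)"
      by (simp flip: exp_add)
    also have "\<dots> \<le> U * w ^ (m - k)"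
      using U * q Upos by (intro mult_mono) auto
    finally show ?thesis .
  qed
  \<comment> \<open>By convexity every later drop of \<open>x * h\<close> is at most
    \<open>d / 4\<close>, so the doubled exponent recovers at most \<open>d / 2\<close> per step,
    less than the \<open>d\<close> lost to \<open>q\<close>.\<close>
  have high: "exp (- 2 * x * h (m + i)) * q ^ (m + i) \<le> U * w ^ i" for i
  proof -
    have "2 * (x * (h m - h (m + i))) \<le> 2 * (d / 4 * real i)"
    proof (induction i)
      case (Suc i)
      have "lam (m + i) \<le> lam m"
        using decseqD[OF conv, of m "m + i"] by (simp add: lam_def)
      then have "x * lam (m + i) \<le> d / 4"
        using mult_left_mono[OF _ x, of "lam (m + i)" "lam m"] m1 by linarith
      then show ?case using Suc by (simp add: lam_def algebra_simps)
    qed simp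
    then have "- 2 * x * h (m + i) - d * real i \<le> - 2 * x * h m - d / 4 * real i - d / 4 * real i"
      by (simp add: algebra_simps)
    then have "- 2 * x * h (m + i) - d * real i \<le> - 2 * x * h m - d / 4 * real i"
      using d mult_nonneg_nonneg[of d "real i"] by linarith
    then have "exp (- 2 * x * h (m + i) - d * real i) \<le> exp (- 2 * x * h m - d / 4 * real i)"
      by simp
    then have *: "exp (- 2 * x * h (m + i)) * q ^ i \<le> exp (- 2 * x * h m) * w ^ i"
      by (simp add: qd w_def exp_add exp_diff flip: exp_of_nat_mult)
         (simp add: exp_minus field_simps)
    have "exp (- 2 * x * h m) * q ^ m \<le> exp (- x * h m) * q ^ m"
      using q x hpos[of m] by (intro mult_right_mono) auto
    also have "\<dots> \<le> U" by (rule U)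
    finally have **: "exp (- 2 * x * h m) * q ^ m \<le> U" .
    have "exp (- 2 * x * h (m + i)) * q ^ (m + i) = exp (- 2 * x * h (m + i)) * q ^ i * q ^ m"
      by (simp add: power_add)
    also have "\<dots> \<le> exp (- 2 * x * h m) * w ^ i * q ^ m"
      using * q by (intro mult_right_mono) auto
    also have "\<dots> = exp (- 2 * x * h m) * q ^ m * w ^ i"
      by simp
    also have "\<dots> \<le> U * w ^ i"
      using ** w by (intro mult_right_mono) auto
    finally show ?thesis .
  qed
  have "(\<Sum>k\<le>K. exp (- 2 * x * h k) * q ^ k)
      \<le> (\<Sum>k<m + Suc K. exp (- 2 * x * h k) * q ^ k)"
    using q by (intro sum_mono2) auto
  also have "\<dots> = (\<Sum>k<m. exp (- 2 * x * h k) * q ^ k)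
      + (\<Sum>i<Suc K. exp (- 2 * x * h (m + i)) * q ^ (m + i))"
    by (induction K) (auto simp: algebra_simps)
  also have "\<dots> \<le> (\<Sum>k<m. U * w ^ (m - k)) + (\<Sum>i<Suc K. U * w ^ i)"
    using low high by (intro add_mono sum_mono) auto
  also have "\<dots> = U * ((\<Sum>k<m. w ^ (m - k)) + (\<Sum>i\<in>{0..<Suc K}. w ^ i))"
    by (simp add: sum_distrib_left algebra_simps atLeast0LessThan)
  also have "\<dots> \<le> U * (1 / (1 - w) + 1 / (1 - w))"
    using sum_lessThan_reflect_geometric_le[of w m] sum_geometric_le[of w 0 "Suc K"] w Upos
    by (intro mult_left_mono add_mono) auto
  finally show ?thesis by (simp add: w_eq mult.commute)
qed

section \<open>Splitting intervals into consecutive blocks\<close>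

lemma disjoint_family_Ioc_incseq:
  fixes a :: "nat \<Rightarrow> real"
  assumes "incseq a"
  shows "disjoint_family (\<lambda>j. {a j<..a (Suc j)})"
proof -
  have "{a i<..a (Suc i)} \<inter> {a j<..a (Suc j)} = {}" if "i < j" for i j
    using incseqD[OF assms, of "Suc i" j] that by auto
  then show ?thesis
    unfolding disjoint_family_on_def by (metis Int_commute linorder_neqE_nat)
qed

lemma disjoint_family_Ioc_decseq:
  fixes a :: "nat \<Rightarrow> real"
  assumes "decseq a"
  shows "disjoint_family (\<lambda>j. {a (Suc j)<..a j})"
proof -
  have "{a (Suc i)<..a i} \<inter> {a (Suc j)<..a j} = {}" if "i < j" for i j
    using decseqD[OF assms, of "Suc i" j] that by auto
  then show ?thesis
    unfolding disjoint_family_on_def by (metis Int_commute linorder_neqE_nat)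
qed

lemma UN_Ioc_decseq:
  fixes a :: "nat \<Rightarrow> real"
  assumes a: "decseq a" "a \<longlonglongrightarrow> 0" "\<And>j. 0 < a j"
  shows "(\<Union>j. {a (Suc j)<..a j}) = {0<..a 0}"
proof (intro equalityI subsetI)
  fix t assume "t \<in> (\<Union>j. {a (Suc j)<..a j})"
  then obtain j where "a (Suc j) < t" "t \<le> a j" by auto
  then show "t \<in> {0<..a 0}"
    using a(3)[of "Suc j"] decseqD[OF a(1), of 0 j] by auto
next
  fix t assume t: "t \<in> {0<..a 0}"
  then have "eventually (\<lambda>j. a j < t) sequentially"
    using a(2) order_tendstoD(2)[of a 0 sequentially t] by simp
  then have ex: "\<exists>j. a j < t" by (auto simp: eventually_sequentially)
  define m where "m = (LEAST j. a j < t)"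
  have m: "a m < t" unfolding m_def by (rule LeastI_ex[OF ex])
  then obtain i where i: "m = Suc i" using t by (cases m) auto
  then have "\<not> a i < t" using not_less_Least[of i "\<lambda>j. a j < t"] by (simp add: m_def)
  then show "t \<in> (\<Union>j. {a (Suc j)<..a j})" using m i by auto
qed

section \<open>Dyadic values of the weight and their tail sums\<close>

locale slow_weight =
  fixes l :: "real \<Rightarrow> real"
  assumes l_pos: "\<And>t. 0 \<le> t \<Longrightarrow> 0 < l t"
    and l_cont: "continuous_on {0..} l"
    and l_mono: "mono_on {0..} l"
    and l_slow: "slowly_varying l"
    and l_int: "set_integrable lborel {1..} (\<lambda>t. 1 / (t * l t))"
begin

definition lam :: "nat \<Rightarrow> real" where "lam j = 1 / l (4 ^ j)"

definition tail :: "nat \<Rightarrow> real" where "tail k = (\<Sum>j. lam (k + j))"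

text \<open>For nonzero \<open>s\<close> this is the reciprocal of \<open>theta l s\<close>.\<close>

definition J :: "real \<Rightarrow> real" where "J s = (LINT t:{0<..1/s}|lborel. 1 / (t * l (1 / t)))"

lemma l_nonneg: "0 \<le> t \<Longrightarrow> 0 \<le> l t"
  using l_pos[of t] by simp

lemma lam_pos: "0 < lam j"
  using l_pos[of "4 ^ j"] by (simp add: lam_def)

lemma lam_nonneg: "0 \<le> lam j"
  using lam_pos[of j] by simp

lemma l_le: "0 \<le> s \<Longrightarrow> s \<le> t \<Longrightarrow> l s \<le> l t"
  using l_mono by (auto simp: mono_on_def)

lemma decseq_lam: "decseq lam"
  unfolding decseq_def lam_def
  by (auto intro!: divide_left_mono l_le mult_pos_pos l_pos power_increasing)

text \<open>Integral test on the blocks between consecutive powers of 4: there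
  \<open>t * l t\<close> is at most \<open>4 ^ Suc j * l (4 ^ Suc j)\<close>, and the block has
  length \<open>3 * 4 ^ j\<close>, whence the factor \<open>3 / 4\<close>.\<close>

lemma summable_lam: "summable lam"
proof -
  let ?f = "\<lambda>t. ennreal (1 / (t * l t)) * indicator {1..} t"
  let ?B = "\<lambda>j::nat. {4 ^ j<..4 ^ Suc j :: real}"
  have int: "integrable lborel (\<lambda>t. indicator {1..} t *\<^sub>R (1 / (t * l t)))"
    using l_int by (simp add: set_integrable_def)
  have eq: "?f = (\<lambda>t. ennreal (indicator {1..} t *\<^sub>R (1 / (t * l t))))"
    by (auto simp: fun_eq_iff indicator_def)
  have [measurable]: "?f \<in> borel_measurable lborel"
    unfolding eq using borel_measurable_integrable[OF int] by measurable
  have "(\<integral>\<^sup>+t. ?f t \<partial>lborel) = ennreal (\<integral>t. indicator {1..} t *\<^sub>R (1 / (t * l t)) \<partial>lborel)"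
    unfolding eq using l_pos
    by (intro nn_integral_eq_integral[OF int] AE_I2)
       (auto simp: indicator_def intro!: mult_nonneg_nonneg l_nonneg)
  then have fin: "(\<integral>\<^sup>+t. ?f t \<partial>lborel) < \<top>" by simp
  have piece: "ennreal (3 / 4 * lam (Suc j)) \<le> (\<integral>\<^sup>+t\<in>?B j. ?f t \<partial>lborel)" for j
  proof -
    have "ennreal (3 / 4 * lam (Suc j)) = ennreal (lam (Suc j) / 4 ^ Suc j) * emeasure lborel (?B j)"
      using lam_pos[of "Suc j"] by (simp flip: ennreal_mult)
    also have "\<dots> = (\<integral>\<^sup>+t. ennreal (lam (Suc j) / 4 ^ Suc j) * indicator (?B j) t \<partial>lborel)"
      by (intro nn_integral_cmult_indicator[symmetric]) auto
    also have "\<dots> \<le> (\<integral>\<^sup>+t\<in>?B j. ?f t \<partial>lborel)"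
    proof (rule nn_integral_mono)
      fix t
      show "ennreal (lam (Suc j) / 4 ^ Suc j) * indicator (?B j) t \<le> ?f t * indicator (?B j) t"
      proof (cases "t \<in> ?B j")
        case True
        have "(1::real) \<le> 4 ^ j" by simp
        then have t: "1 \<le> t" "t \<le> 4 ^ Suc j"
          using True unfolding greaterThanAtMost_iff by linarith+
        have "t * l t \<le> 4 ^ Suc j * l (4 ^ Suc j)"
          using t by (intro mult_mono l_le l_nonneg) auto
        then have "1 / (4 ^ Suc j * l (4 ^ Suc j)) \<le> 1 / (t * l t)"
          using t l_pos[of t] l_pos[of "4 ^ Suc j"] by (intro divide_left_mono) auto
        then have "lam (Suc j) / 4 ^ Suc j \<le> 1 / (t * l t)"
          by (simp add: lam_def mult.commute)
        then show ?thesis using True t by (simp add: ennreal_leI)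
      qed simp
    qed
    finally show ?thesis .
  qed
  have "incseq (\<lambda>j. 4 ^ j :: real)"
    by (intro incseq_SucI) simp
  note disj = disjoint_family_Ioc_incseq[OF this]
  have "(\<Sum>j. ennreal (3 / 4 * lam (Suc j))) \<le> (\<Sum>j. (\<integral>\<^sup>+t\<in>?B j. ?f t \<partial>lborel))"
    using piece by (intro suminf_le) auto
  also have "\<dots> = (\<integral>\<^sup>+t\<in>(\<Union>j. ?B j). ?f t \<partial>lborel)"
    using disj by (intro nn_integral_disjoint_family[symmetric]) auto
  also have "\<dots> \<le> (\<integral>\<^sup>+t. ?f t \<partial>lborel)"
    by (intro nn_integral_mono) (auto simp: indicator_def)
  finally have "(\<Sum>j. ennreal (3 / 4 * lam (Suc j))) \<noteq> \<top>"
    using fin by (auto simp: top_unique)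
  then have "summable (\<lambda>j. 3 / 4 * lam (Suc j))"
    using lam_nonneg by (intro summable_suminf_not_top) auto
  then show ?thesis
    by (simp add: summable_Suc_iff)
qed

lemma summable_lam_shift: "summable (\<lambda>j. lam (k + j))"
  using summable_ignore_initial_segment[OF summable_lam, of k] by (simp add: add.commute)

lemma tail_pos: "0 < tail k"
  unfolding tail_def using lam_pos by (intro suminf_pos summable_lam_shift)

lemma tail_Suc: "tail k = lam k + tail (Suc k)"
  unfolding tail_def using suminf_split_head[OF summable_lam_shift[of k]] by simp

lemma decseq_tail: "decseq tail"
proof (intro decseq_SucI)
  show "tail (Suc k) \<le> tail k" for k
    using tail_Suc[of k] lam_nonneg[of k] by simp
qed

lemma tail_mono: "i \<le> k \<Longrightarrow> tail k \<le> tail i"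
  using decseqD[OF decseq_tail] .

lemma decseq_tail_diff: "decseq (\<lambda>k. tail k - tail (Suc k))"
proof -
  have "tail k - tail (Suc k) = lam k" for k
    using tail_Suc[of k] by simp
  then show ?thesis using decseq_lam by simp
qed

lemma sum_lam: "i \<le> k \<Longrightarrow> (\<Sum>j\<in>{i..<k}. lam j) = tail i - tail k"
proof (induction k rule: dec_induct)
  case (step n)
  then show ?case using tail_Suc[of n] by simp
qed simp

lemma tail_tendsto: "tail \<longlonglongrightarrow> 0"
  unfolding tail_def using suminf_exist_split2[OF summable_lam] by (simp add: add.commute)

text \<open>Slow variation at the dilation 4. The ratio 2 is chosen below 4, so that later the bound
  for \<open>4 ^ i * tail i\<close> grows geometrically in \<open>i\<close>.\<close>

lemma lam_eventually_le: "\<exists>i0. \<forall>i\<ge>i0. lam i \<le> 2 * lam (Suc i)"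
proof -
  have "((\<lambda>t. l (4 * t) / l t) \<longlongrightarrow> 1) at_top"
    using l_slow by (auto simp: slowly_varying_def)
  then have "eventually (\<lambda>t. l (4 * t) / l t < 2) at_top"
    by (rule order_tendstoD) simp
  moreover have "filterlim (\<lambda>j::nat. 4 ^ j :: real) at_top sequentially"
    by real_asymp
  ultimately have "eventually (\<lambda>j. l (4 * 4 ^ j) / l (4 ^ j) < 2) sequentially"
    by (auto simp: filterlim_iff)
  then have "eventually (\<lambda>j. lam j \<le> 2 * lam (Suc j)) sequentially"
  proof eventually_elim
    case (elim j)
    then show ?case
      using l_pos[of "4 ^ j"] l_pos[of "4 * 4 ^ j"] by (simp add: lam_def field_simps)
  qed
  then show ?thesis by (simp add: eventually_sequentially)
qed

text \<open>The finitely many indices below \<open>i0\<close> are absorbed into the constant, since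
  \<open>lam\<close> is positive and decreasing.\<close>

lemma lam_doubling: "\<exists>C>0. \<forall>j. lam j \<le> C * lam (Suc j)"
proof -
  obtain i0 where i0: "\<And>i. i \<ge> i0 \<Longrightarrow> lam i \<le> 2 * lam (Suc i)"
    using lam_eventually_le by auto
  have "lam j \<le> (2 + lam 0 / lam i0) * lam (Suc j)" for j
  proof (cases "j \<ge> i0")
    case True
    have "0 \<le> lam 0 / lam i0 * lam (Suc j)" using lam_pos by (simp add: less_imp_le)
    then show ?thesis using i0[OF True] by (simp add: distrib_right)
  next
    case False
    have "lam j \<le> lam 0" "lam i0 \<le> lam (Suc j)"
      using decseqD[OF decseq_lam] False by auto
    then have "lam j \<le> lam 0 / lam i0 * lam (Suc j)"
      using lam_pos[of i0] mult_mono[of "lam i0" "lam (Suc j)" "lam j" "lam 0"] lam_nonneg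
      by (simp add: pos_le_divide_eq mult.commute)
    then show ?thesis using lam_pos[of "Suc j"] by (simp add: distrib_right add_increasing)
  qed
  moreover have "0 < 2 + lam 0 / lam i0" using lam_pos by (simp add: add_pos_pos)
  ultimately show ?thesis by blast
qed

text \<open>Summing the eventual ratio bound of \<open>lam\<close> gives the ratio 2 for
  \<open>tail\<close> as well; ranges that start below \<open>i0\<close> cost the factor
  \<open>tail 0 / tail i0\<close>.\<close>

lemma tail_geometric: "\<exists>C\<ge>1. \<forall>i k. i \<le> k \<longrightarrow> tail i \<le> C * 2 ^ (k - i) * tail k"
proof -
  obtain i0 where i0: "\<And>i. i \<ge> i0 \<Longrightarrow> lam i \<le> 2 * lam (Suc i)"
    using lam_eventually_le by auto
  have tail_step: "tail i \<le> 2 * tail (Suc i)" if "i \<ge> i0" for i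
    unfolding tail_def using summable_lam_shift[of i] summable_lam_shift[of "Suc i"] i0 that
    by (subst suminf_mult[symmetric]) (auto intro!: suminf_le summable_mult)
  have high: "tail i \<le> 2 ^ (k - i) * tail k" if "i0 \<le> i" "i \<le> k" for i k
    using that(2)
  proof (induction k rule: dec_induct)
    case (step n)
    have "tail i \<le> 2 ^ (n - i) * (2 * tail (Suc n))"
      using that(1) step.hyps by (intro order_trans[OF step.IH] mult_left_mono tail_step) auto
    then show ?case using step.hyps by (simp add: Suc_diff_le)
  qed simp
  define C where "C = tail 0 / tail i0"
  have C: "1 \<le> C" using tail_pos[of i0] tail_mono[of 0 i0] by (simp add: C_def)
  have "tail i \<le> C * 2 ^ (k - i) * tail k" if "i \<le> k" for i k
  proof (cases "i0 \<le> i")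
    case True
    have "1 * (2 ^ (k - i) * tail k) \<le> C * (2 ^ (k - i) * tail k)"
      using C tail_pos[of k] by (intro mult_right_mono) auto
    then show ?thesis using high[OF True that] by (simp only: mult.assoc mult_1_left order_trans)
  next
    case False
    have 1: "tail i \<le> C * tail i0"
      using tail_mono[of 0 i] tail_pos[of i0] by (simp add: C_def)
    have 2: "tail i0 \<le> 2 ^ (k - i) * tail k"
    proof (cases "i0 \<le> k")
      case True
      have "tail i0 \<le> 2 ^ (k - i0) * tail k" using high True by simp
      also have "\<dots> \<le> 2 ^ (k - i) * tail k"
        using False tail_pos[of k] by (intro mult_right_mono power_increasing) auto
      finally show ?thesis .
    next
      case False
      then have "tail i0 \<le> 1 * tail k" using tail_mono[of k i0] by simp
      also have "\<dots> \<le> 2 ^ (k - i) * tail k"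
        using tail_pos[of k] by (intro mult_right_mono) auto
      finally show ?thesis .
    qed
    show ?thesis
      using order_trans[OF 1 mult_left_mono[OF 2, of C]] C by (simp add: mult.assoc)
  qed
  then show ?thesis using C by blast
qed

section \<open>Comparison of the integral defining \<open>theta\<close> with the tail sums\<close>

lemma l_inverse_measurable:
  "(\<lambda>t. ennreal (1 / (t * l (1 / t)) * indicator {0<..} t)) \<in> borel_measurable lborel"
proof -
  have "continuous_on {0<..} (\<lambda>t. l (1 / t))"
    by (intro continuous_on_compose2[OF l_cont] continuous_intros) auto
  then have "continuous_on {0<..} (\<lambda>t. 1 / (t * l (1 / t)))"
    using l_pos by (intro continuous_intros) (auto simp: less_le)
  then have "(\<lambda>t. indicator {0<..} t *\<^sub>R (1 / (t * l (1 / t)))) \<in> borel_measurable borel"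
    by (intro borel_measurable_continuous_on_indicator) auto
  then have "(\<lambda>t. ennreal (indicator {0<..} t *\<^sub>R (1 / (t * l (1 / t))))) \<in> borel_measurable lborel"
    by measurable
  then show ?thesis by (simp add: mult.commute)
qed

text \<open>Cut the domain at the powers of \<open>1 / 4\<close>. On the block of index
  \<open>j\<close> the argument \<open>1 / t\<close> lies between \<open>4 ^ (k + j)\<close> and
  \<open>4 ^ Suc (k + j)\<close>, so monotonicity of \<open>l\<close> pins the integrand; the block
  length times these bounds gives the constants \<open>3 / 4\<close> and 3. With nonnegative
  integrals the finiteness comes out as a by-product.\<close>

lemma nn_integral_J:
  "ennreal (3 / 4 * tail (Suc k)) \<le> (\<integral>\<^sup>+t\<in>{0<..1 / 4 ^ k}. ennreal (1 / (t * l (1 / t))) \<partial>lborel)"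
  "(\<integral>\<^sup>+t\<in>{0<..1 / 4 ^ k}. ennreal (1 / (t * l (1 / t))) \<partial>lborel) \<le> ennreal (3 * tail k)"
proof -
  let ?f = "\<lambda>t. ennreal (1 / (t * l (1 / t)) * indicator {0<..} t)"
  define a where "a j = 1 / (4::real) ^ (k + j)" for j
  let ?B = "\<lambda>j. {a (Suc j)<..a j}"
  have a_pos: "0 < a j" for j by (simp add: a_def)
  have a_dec: "decseq a" by (intro decseq_SucI) (simp add: a_def field_simps)
  have a0: "a \<longlonglongrightarrow> 0"
  proof -
    have "a = (\<lambda>j. 1 / 4 ^ k * (1 / 4) ^ j :: real)"
      by (simp add: fun_eq_iff a_def power_add power_one_over)
    moreover have "(\<lambda>j. 1 / 4 ^ k * (1 / 4) ^ j :: real) \<longlonglongrightarrow> 1 / 4 ^ k * 0"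
      by (intro tendsto_intros LIMSEQ_power_zero) simp
    ultimately show ?thesis by simp
  qed
  have meas: "emeasure lborel (?B j) = ennreal (3 / 4 ^ Suc (k + j))" for j
  proof -
    have "a j - a (Suc j) = 3 / 4 ^ Suc (k + j)" by (simp add: a_def field_simps)
    then show ?thesis using decseqD[OF a_dec, of j "Suc j"] by simp
  qed
  have ptw: "4 ^ (k + j) * lam (Suc (k + j)) \<le> 1 / (t * l (1 / t))"
      "1 / (t * l (1 / t)) \<le> 4 ^ Suc (k + j) * lam (k + j)" if "t \<in> ?B j" for t j
  proof -
    have t: "0 < t" "t \<le> 1 / 4 ^ (k + j)" "1 / 4 ^ Suc (k + j) < t"
      using that less_trans[OF a_pos[of "Suc j"], of t] by (auto simp: a_def simp del: power_Suc)
    have t': "1 / t \<le> 4 ^ Suc (k + j)" "4 ^ (k + j) \<le> 1 / t"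
      using t by (simp_all add: field_simps)
    have "t * l (1 / t) \<le> 1 / 4 ^ (k + j) * l (4 ^ Suc (k + j))"
      using t t' by (intro mult_mono l_le l_nonneg) auto
    then have "1 / (1 / 4 ^ (k + j) * l (4 ^ Suc (k + j))) \<le> 1 / (t * l (1 / t))"
      using t l_pos[of "1 / t"] l_pos[of "4 ^ Suc (k + j)"] by (intro divide_left_mono) auto
    then show "4 ^ (k + j) * lam (Suc (k + j)) \<le> 1 / (t * l (1 / t))"
      by (simp add: lam_def)
    have "1 / 4 ^ Suc (k + j) * l (4 ^ (k + j)) \<le> t * l (1 / t)"
      using t t' by (intro mult_mono l_le l_nonneg) auto
    then have "1 / (t * l (1 / t)) \<le> 1 / (1 / 4 ^ Suc (k + j) * l (4 ^ (k + j)))"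
      using t l_pos[of "1 / t"] l_pos[of "4 ^ (k + j)"] by (intro divide_left_mono) auto
    then show "1 / (t * l (1 / t)) \<le> 4 ^ Suc (k + j) * lam (k + j)"
      by (simp add: lam_def)
  qed
  have "{0<..1 / 4 ^ k} = (\<Union>j. ?B j)"
    using UN_Ioc_decseq[OF a_dec a0 a_pos] by (simp add: a_def)
  then have "(\<integral>\<^sup>+t\<in>{0<..1 / 4 ^ k}. ennreal (1 / (t * l (1 / t))) \<partial>lborel)
      = (\<integral>\<^sup>+t\<in>(\<Union>j. ?B j). ?f t \<partial>lborel)"
    using less_trans[OF a_pos] by (auto intro!: nn_integral_cong simp: indicator_def)
  also have "\<dots> = (\<Sum>j. (\<integral>\<^sup>+t\<in>?B j. ?f t \<partial>lborel))"
    using disjoint_family_Ioc_decseq[OF a_dec] l_inverse_measurable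
    by (intro nn_integral_disjoint_family) auto
  finally have eq: "(\<integral>\<^sup>+t\<in>{0<..1 / 4 ^ k}. ennreal (1 / (t * l (1 / t))) \<partial>lborel)
      = (\<Sum>j. (\<integral>\<^sup>+t\<in>?B j. ?f t \<partial>lborel))" .
  have lo: "ennreal (3 / 4 * lam (Suc k + j)) \<le> (\<integral>\<^sup>+t\<in>?B j. ?f t \<partial>lborel)" for j
  proof -
    have "ennreal (3 / 4 * lam (Suc k + j)) = ennreal (4 ^ (k + j) * lam (Suc (k + j))) * emeasure lborel (?B j)"
      unfolding meas using lam_pos[of "Suc (k + j)"] by (simp flip: ennreal_mult)
    also have "\<dots> = (\<integral>\<^sup>+t. ennreal (4 ^ (k + j) * lam (Suc (k + j))) * indicator (?B j) t \<partial>lborel)"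
      by (intro nn_integral_cmult_indicator[symmetric]) auto
    also have "\<dots> \<le> (\<integral>\<^sup>+t\<in>?B j. ?f t \<partial>lborel)"
      using ptw(1)[of _ j] less_trans[OF a_pos[of "Suc j"]]
      by (intro nn_integral_mono) (auto simp: indicator_def intro!: ennreal_leI)
    finally show ?thesis .
  qed
  have hi: "(\<integral>\<^sup>+t\<in>?B j. ?f t \<partial>lborel) \<le> ennreal (3 * lam (k + j))" for j
  proof -
    have "(\<integral>\<^sup>+t\<in>?B j. ?f t \<partial>lborel)
        \<le> (\<integral>\<^sup>+t. ennreal (4 ^ Suc (k + j) * lam (k + j)) * indicator (?B j) t \<partial>lborel)"
      using ptw(2)[of _ j] less_trans[OF a_pos[of "Suc j"]]
      by (intro nn_integral_mono) (auto simp: indicator_def intro!: ennreal_leI)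
    also have "\<dots> = ennreal (4 ^ Suc (k + j) * lam (k + j)) * emeasure lborel (?B j)"
      by (intro nn_integral_cmult_indicator) auto
    also have "\<dots> = ennreal (3 * lam (k + j))"
      unfolding meas using lam_pos[of "k + j"] by (simp flip: ennreal_mult)
    finally show ?thesis .
  qed
  have "ennreal (3 / 4 * tail (Suc k)) = (\<Sum>j. ennreal (3 / 4 * lam (Suc k + j)))"
    unfolding tail_def using lam_pos summable_lam_shift
    by (subst suminf_ennreal2)
       (auto intro!: lam_nonneg summable_mult mult_nonneg_nonneg
         simp: suminf_mult simp del: add_Suc times_divide_eq_left)
  also have "\<dots> \<le> (\<Sum>j. (\<integral>\<^sup>+t\<in>?B j. ?f t \<partial>lborel))"
    using lo by (intro suminf_le) auto
  finally show "ennreal (3 / 4 * tail (Suc k))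
      \<le> (\<integral>\<^sup>+t\<in>{0<..1 / 4 ^ k}. ennreal (1 / (t * l (1 / t))) \<partial>lborel)"
    unfolding eq .
  have "(\<Sum>j. (\<integral>\<^sup>+t\<in>?B j. ?f t \<partial>lborel)) \<le> (\<Sum>j. ennreal (3 * lam (k + j)))"
    using hi by (intro suminf_le) auto
  also have "\<dots> = ennreal (3 * tail k)"
    unfolding tail_def using lam_pos summable_lam_shift
    by (subst suminf_ennreal2) (auto intro!: lam_nonneg summable_mult simp: suminf_mult)
  finally show "(\<integral>\<^sup>+t\<in>{0<..1 / 4 ^ k}. ennreal (1 / (t * l (1 / t))) \<partial>lborel) \<le> ennreal (3 * tail k)"
    unfolding eq .
qed

text \<open>For \<open>1 \<le> s\<close> the domain lies in \<open>{0<..1}\<close>, where the block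
  bound with index 0 makes the integrand integrable.\<close>

lemma ennreal_J:
  assumes "1 \<le> s"
  shows "ennreal (J s) = (\<integral>\<^sup>+t\<in>{0<..1 / s}. ennreal (1 / (t * l (1 / t))) \<partial>lborel)"
    and "0 \<le> J s"
proof -
  let ?g = "\<lambda>t. indicator {0<..1 / s} t *\<^sub>R (1 / (t * l (1 / t)))"
  have g0: "0 \<le> ?g t" for t
    using l_pos[of "1 / t"] by (auto simp: indicator_def)
  have eq: "(\<lambda>t. ennreal (?g t)) = (\<lambda>t. ennreal (1 / (t * l (1 / t))) * indicator {0<..1 / s} t)"
    by (auto simp: fun_eq_iff indicator_def)
  \<comment> \<open>\<open>l (1 / t)\<close> is controlled only for positive \<open>t\<close>, so
    measurability is transferred from the version cut off to the positive half-line.\<close>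
  have eq2: "?g = (\<lambda>t. indicator {0<..1 / s} t * enn2real (ennreal (1 / (t * l (1 / t)) * indicator {0<..} t)))"
    using l_pos by (auto simp: fun_eq_iff indicator_def l_nonneg enn2real_ennreal)
  have meas: "?g \<in> borel_measurable lborel"
    unfolding eq2 using l_inverse_measurable by measurable
  have "(\<integral>\<^sup>+t. ennreal (?g t) \<partial>lborel) \<le> (\<integral>\<^sup>+t\<in>{0<..1 / 4 ^ 0}. ennreal (1 / (t * l (1 / t))) \<partial>lborel)"
    unfolding eq
  proof (intro nn_integral_mono)
    fix t :: real
    have "1 / s \<le> 1 / 4 ^ 0" using assms by simp
    then have "{0<..1 / s} \<subseteq> {0<..1 / 4 ^ 0}" by auto
    then show "ennreal (1 / (t * l (1 / t))) * indicator {0<..1 / s} t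
        \<le> ennreal (1 / (t * l (1 / t))) * indicator {0<..1 / 4 ^ 0} t"
      by (intro mult_left_mono indicator_leI) auto
  qed
  also have "\<dots> < \<top>"
    using nn_integral_J(2)[of 0] by (rule le_less_trans) simp
  finally have "integrable lborel ?g"
    using meas g0 by (intro integrableI_nonneg) auto
  from nn_integral_eq_integral[OF this] g0
  have "(\<integral>\<^sup>+t. ennreal (?g t) \<partial>lborel) = ennreal (J s)"
    unfolding J_def set_lebesgue_integral_def by blast
  then show "ennreal (J s) = (\<integral>\<^sup>+t\<in>{0<..1 / s}. ennreal (1 / (t * l (1 / t))) \<partial>lborel)"
    unfolding eq by simp
  show "0 \<le> J s"
    unfolding J_def set_lebesgue_integral_def using g0 by (intro integral_nonneg_AE) auto
qed

lemma J_antimono: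
  assumes "1 \<le> s" "s \<le> s'"
  shows "J s' \<le> J s"
proof -
  have "1 / s' \<le> 1 / s" using assms by (intro divide_left_mono) auto
  then have "{0<..1 / s'} \<subseteq> {0<..1 / s}" by auto
  then have "ennreal (J s') \<le> ennreal (J s)"
    using assms unfolding ennreal_J(1)[OF assms(1)] ennreal_J(1)[OF order_trans[OF assms]]
    by (intro nn_integral_mono mult_left_mono indicator_leI) auto
  then show ?thesis using ennreal_J(2)[OF assms(1)] by simp
qed

lemma J_bounds: "3 / 4 * tail (Suc k) \<le> J (4 ^ k)" "J (4 ^ k) \<le> 3 * tail k"
proof -
  have 1: "1 \<le> (4::real) ^ k" by simp
  have "ennreal (3 / 4 * tail (Suc k)) \<le> ennreal (J (4 ^ k))"
    using nn_integral_J(1) by (simp add: ennreal_J[OF 1])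
  then show "3 / 4 * tail (Suc k) \<le> J (4 ^ k)"
    using ennreal_J(2)[OF 1] by simp
  have "ennreal (J (4 ^ k)) \<le> ennreal (3 * tail k)"
    using nn_integral_J(2) by (simp add: ennreal_J[OF 1])
  then show "J (4 ^ k) \<le> 3 * tail k"
    using tail_pos[of k] by simp
qed

lemma J_pos: "1 \<le> s \<Longrightarrow> 0 < J s"
proof -
  assume s: "1 \<le> s"
  obtain k :: nat where "s < 4 ^ k" using real_arch_pow[of 4 s] by auto
  then have "J (4 ^ k) \<le> J s" using s by (intro J_antimono) auto
  then show ?thesis using J_bounds(1)[of k] tail_pos[of "Suc k"] by simp
qed

lemma theta2_eq: "r \<noteq> 0 \<Longrightarrow> theta2 l r = 1 / (2 * J (r\<^sup>2))"
  by (simp add: theta2_def theta_def J_def)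

end

section \<open>Convolution powers on a group\<close>

context group
begin

section \<open>Convolution in the pmf monad, symmetry and the convolution formula\<close>

text \<open>The monadic form reduces the algebra of convolution to the monad laws and to the group
  axioms on the supports.\<close>

lemma conv_eq_bind: "conv G \<mu> \<nu> = bind_pmf \<mu> (\<lambda>x. bind_pmf \<nu> (\<lambda>y. return_pmf (x \<otimes> y)))"
  by (simp add: conv_def pair_pmf_def map_pmf_def bind_assoc_pmf bind_return_pmf)

lemma prob_on_conv: "prob_on G \<mu> \<Longrightarrow> prob_on G \<nu> \<Longrightarrow> prob_on G (conv G \<mu> \<nu>)"
  by (auto simp: prob_on_def conv_eq_bind)

lemma prob_on_conv_power: "prob_on G \<mu> \<Longrightarrow> prob_on G (conv_power G \<mu> n)"
  by (induction n) (auto simp: prob_on_conv, simp add: prob_on_def)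

lemma conv_return_right:
  assumes "prob_on G \<mu>"
  shows "conv G \<mu> (return_pmf \<one>) = \<mu>"
proof -
  have "conv G \<mu> (return_pmf \<one>) = bind_pmf \<mu> return_pmf"
    unfolding conv_eq_bind bind_return_pmf
    using assms by (intro bind_pmf_cong refl) (auto simp: prob_on_def)
  then show ?thesis by (simp add: bind_return_pmf')
qed

lemma conv_return_left:
  assumes "prob_on G \<mu>"
  shows "conv G (return_pmf \<one>) \<mu> = \<mu>"
proof -
  have "conv G (return_pmf \<one>) \<mu> = bind_pmf \<mu> return_pmf"
    unfolding conv_eq_bind bind_return_pmf
    using assms by (intro bind_pmf_cong refl) (auto simp: prob_on_def)
  then show ?thesis by (simp add: bind_return_pmf')
qed

lemma conv_assoc:
  assumes "prob_on G \<mu>" "prob_on G \<nu>" "prob_on G \<rho>"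
  shows "conv G (conv G \<mu> \<nu>) \<rho> = conv G \<mu> (conv G \<nu> \<rho>)"
  unfolding conv_eq_bind bind_assoc_pmf bind_return_pmf
  using assms by (intro bind_pmf_cong refl) (auto simp: prob_on_def m_assoc subset_eq)

lemma conv_power_add:
  assumes "prob_on G \<mu>"
  shows "conv_power G \<mu> (j + k) = conv G (conv_power G \<mu> j) (conv_power G \<mu> k)"
  using assms
  by (induction k) (simp_all add: conv_return_right prob_on_conv_power conv_assoc)

text \<open>Symmetry becomes an equation between pmfs, which can be carried through convolutions.
  Inversion is known to be injective on the carrier, whence the intersections with
  \<open>set_pmf \<mu>\<close>.\<close>

lemma symmetric_on_iff_map:
  assumes "prob_on G \<mu>"
  shows "symmetric_on G \<mu> \<longleftrightarrow> map_pmf (\<lambda>x. inv x) \<mu> = \<mu>"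
proof -
  have pmf_inv: "pmf (map_pmf (\<lambda>x. inv x) \<mu>) (inv x) = pmf \<mu> x" if "x \<in> carrier G" for x
  proof -
    have "(\<lambda>x. inv x) -` {inv x} \<inter> set_pmf \<mu> = {x} \<inter> set_pmf \<mu>"
      using that assms inv_inj by (auto simp: prob_on_def dest: inj_onD subsetD)
    then show ?thesis
      by (metis measure_Int_set_pmf pmf_map measure_pmf_single)
  qed
  have out: "pmf \<nu> x = 0" if "x \<notin> carrier G" "prob_on G \<nu>" for x and \<nu> :: "'a pmf"
    using that by (auto simp: prob_on_def pmf_eq_0_set_pmf)
  have on: "prob_on G (map_pmf (\<lambda>x. inv x) \<mu>)"
    using assms by (auto simp: prob_on_def)
  show ?thesis
  proof
    assume sym: "symmetric_on G \<mu>"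
    show "map_pmf (\<lambda>x. inv x) \<mu> = \<mu>"
    proof (rule pmf_eqI)
      fix x
      show "pmf (map_pmf (\<lambda>x. inv x) \<mu>) x = pmf \<mu> x"
      proof (cases "x \<in> carrier G")
        case True
        then have "pmf \<mu> (inv x) = pmf \<mu> x"
          using sym unfolding symmetric_on_def by (metis (no_types))
        then show ?thesis
          using True pmf_inv[of "inv x"] by simp
      next
        case False
        then show ?thesis
          using out[OF False on] out[OF False assms] by (simp only:)
      qed
    qed
  next
    assume "map_pmf (\<lambda>x. inv x) \<mu> = \<mu>"
    then show "symmetric_on G \<mu>"
      unfolding symmetric_on_def using pmf_inv by metis
  qed
qed

lemma map_inv_conv:
  assumes "prob_on G \<mu>" "prob_on G \<nu>"
  shows "map_pmf (\<lambda>x. inv x) (conv G \<mu> \<nu>)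
    = conv G (map_pmf (\<lambda>x. inv x) \<nu>) (map_pmf (\<lambda>x. inv x) \<mu>)"
proof -
  have "map_pmf (\<lambda>x. inv x) (conv G \<mu> \<nu>)
      = bind_pmf \<mu> (\<lambda>x. bind_pmf \<nu> (\<lambda>y. return_pmf (inv (x \<otimes> y))))"
    by (simp add: conv_eq_bind map_pmf_def bind_assoc_pmf bind_return_pmf)
  also have "\<dots> = bind_pmf \<mu> (\<lambda>x. bind_pmf \<nu> (\<lambda>y. return_pmf (inv y \<otimes> inv x)))"
    using assms by (intro bind_pmf_cong refl) (auto simp: prob_on_def inv_mult_group subset_eq)
  also have "\<dots> = bind_pmf \<nu> (\<lambda>y. bind_pmf \<mu> (\<lambda>x. return_pmf (inv y \<otimes> inv x)))"
    by (rule bind_commute_pmf)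
  finally show ?thesis
    by (simp add: conv_eq_bind map_pmf_def bind_assoc_pmf bind_return_pmf)
qed

lemma symmetric_on_conv_power:
  assumes "prob_on G \<mu>" "symmetric_on G \<mu>"
  shows "symmetric_on G (conv_power G \<mu> n)"
proof -
  have "map_pmf (\<lambda>x. inv x) (conv_power G \<mu> n) = conv_power G \<mu> n"
  proof (induction n)
    case (Suc n)
    \<comment> \<open>Inversion reverses the product, so the last factor moves to the front;
      \<open>conv_power_add\<close> brings it back.\<close>
    have "map_pmf (\<lambda>x. inv x) (conv_power G \<mu> (Suc n)) = conv G \<mu> (conv_power G \<mu> n)"
      using Suc assms by (simp add: map_inv_conv prob_on_conv_power symmetric_on_iff_map)
    also have "\<dots> = conv_power G \<mu> (1 + n)"
      using assms by (subst conv_power_add) (simp_all add: conv_return_left)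
    finally show ?case by simp
  qed simp
  then show ?thesis
    using assms by (simp add: symmetric_on_iff_map prob_on_conv_power)
qed

lemma pmf_conv:
  assumes "prob_on G \<mu>" "prob_on G \<nu>" "x \<in> carrier G"
  shows "ennreal (pmf (conv G \<mu> \<nu>) x)
    = (\<integral>\<^sup>+y. ennreal (pmf \<mu> y) * ennreal (pmf \<nu> (inv y \<otimes> x)) \<partial>count_space (carrier G))"
proof -
  have inner: "pmf (bind_pmf \<nu> (\<lambda>z. return_pmf (y \<otimes> z))) x = pmf \<nu> (inv y \<otimes> x)"
    if "y \<in> carrier G" for y
  proof -
    have "(\<lambda>z. y \<otimes> z) -` {x} \<inter> set_pmf \<nu> = {inv y \<otimes> x} \<inter> set_pmf \<nu>"
      using that assms(2,3) by (auto simp: prob_on_def inv_solve_left subset_eq) (metis inv_solve_left)+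
    then have "pmf (map_pmf (\<lambda>z. y \<otimes> z) \<nu>) x = pmf \<nu> (inv y \<otimes> x)"
      by (metis measure_Int_set_pmf pmf_map measure_pmf_single)
    then show ?thesis by (simp add: map_pmf_def)
  qed
  have out: "pmf \<mu> y = 0" if "y \<notin> carrier G" for y
    using that assms(1) by (auto simp: prob_on_def pmf_eq_0_set_pmf)
  have "ennreal (pmf (conv G \<mu> \<nu>) x) = (\<integral>\<^sup>+y. ennreal (pmf \<mu> y)
      * ennreal (pmf (bind_pmf \<nu> (\<lambda>z. return_pmf (y \<otimes> z))) x) \<partial>count_space UNIV)"
    unfolding conv_eq_bind ennreal_pmf_bind[of \<mu>] nn_integral_measure_pmf[of \<mu>] ..
  also have "\<dots> = (\<integral>\<^sup>+y. ennreal (pmf \<mu> y) * ennreal (pmf \<nu> (inv y \<otimes> x))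
      * indicator (carrier G) y \<partial>count_space UNIV)"
    by (intro nn_integral_cong) (auto simp: inner out indicator_def)
  finally show ?thesis
    by (simp add: nn_integral_count_space_indicator)
qed

lemma bij_betw_translate_inv:
  "x \<in> carrier G \<Longrightarrow> bij_betw (\<lambda>y. inv y \<otimes> x) (carrier G) (carrier G)"
proof (rule bij_betw_byWitness[where f' = "\<lambda>z. x \<otimes> inv z"])
  assume x: "x \<in> carrier G"
  show "\<forall>y\<in>carrier G. x \<otimes> inv (inv y \<otimes> x) = y"
    using x by (metis inv_closed inv_inv inv_mult_group inv_solve_left m_closed)
  show "\<forall>z\<in>carrier G. inv (x \<otimes> inv z) \<otimes> x = z"
    using x by (metis inv_closed inv_inv inv_mult_group inv_solve_right m_closed)
qed auto

lemma bij_betw_translate: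
  "x \<in> carrier G \<Longrightarrow> bij_betw (\<lambda>y. x \<otimes> y) (carrier G) (carrier G)"
  by (rule bij_betw_byWitness[where f' = "\<lambda>z. inv x \<otimes> z"]) (auto simp: m_assoc[symmetric])

text \<open>The uniform bound on the left factor comes out of the convolution formula; after the
  substitution \<open>y \<mapsto> inv y \<otimes> x\<close> only the total mass of
  \<open>\<nu>\<close> is left.\<close>

lemma pmf_conv_le:
  assumes "prob_on G \<mu>" "prob_on G \<nu>" "x \<in> carrier G"
    and "\<And>y. y \<in> carrier G \<Longrightarrow> pmf \<mu> y \<le> c"
  shows "pmf (conv G \<mu> \<nu>) x \<le> c"
proof -
  have "0 \<le> c" by (rule order_trans[OF pmf_nonneg assms(4)[OF assms(3)]])
  have "ennreal (pmf (conv G \<mu> \<nu>) x)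
      \<le> (\<integral>\<^sup>+y. ennreal c * ennreal (pmf \<nu> (inv y \<otimes> x)) \<partial>count_space (carrier G))"
    unfolding pmf_conv[OF assms(1-3)] using assms(4)
    by (intro nn_integral_mono mult_right_mono ennreal_leI) auto
  also have "\<dots> = ennreal c * (\<integral>\<^sup>+y. ennreal (pmf \<nu> y) \<partial>count_space (carrier G))"
    using nn_integral_bij_count_space[OF bij_betw_translate_inv[OF assms(3)], of "\<lambda>y. ennreal (pmf \<nu> y)"]
    by (simp add: nn_integral_cmult)
  also have "\<dots> \<le> ennreal c * 1"
    by (intro mult_left_mono) (auto simp: nn_integral_pmf measure_pmf.emeasure_le_1)
  finally show ?thesis using \<open>0 \<le> c\<close> by simp
qed

section \<open>The transition kernel and on-diagonal bounds\<close>

text \<open>Transition probability from \<open>x\<close> to \<open>y\<close> of the walk that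
  multiplies on the right by steps of law \<open>\<mu>\<close>; it is invariant under left
  translation.\<close>

definition kernel :: "'a pmf \<Rightarrow> nat \<Rightarrow> 'a \<Rightarrow> 'a \<Rightarrow> real" where
  "kernel \<mu> n x y = pmf (conv_power G \<mu> n) (inv x \<otimes> y)"

lemma kernel_nonneg: "0 \<le> kernel \<mu> n x y"
  by (simp add: kernel_def)

text \<open>Chapman-Kolmogorov, with the second leg turned around by symmetry, so that the right
  side is an inner product of two rows of kernels.\<close>

lemma kernel_add:
  assumes \<mu>: "prob_on G \<mu>" "symmetric_on G \<mu>" and xy: "x \<in> carrier G" "y \<in> carrier G"
  shows "ennreal (kernel \<mu> (j + k) x y)
    = (\<integral>\<^sup>+z. ennreal (kernel \<mu> j x z) * ennreal (kernel \<mu> k y z) \<partial>count_space (carrier G))"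
proof -
  have sym: "kernel \<mu> k y z = pmf (conv_power G \<mu> k) (inv (inv x \<otimes> z) \<otimes> (inv x \<otimes> y))"
    if z: "z \<in> carrier G" for z
  proof -
    have "inv (inv x \<otimes> z) \<otimes> (inv x \<otimes> y) = inv (inv y \<otimes> z)"
    proof -
      have "inv (inv x \<otimes> z) \<otimes> (inv x \<otimes> y) = inv z \<otimes> (x \<otimes> inv x) \<otimes> y"
        using xy z by (simp only: inv_mult_group m_assoc inv_closed inv_inv m_closed)
      then show ?thesis using xy z by (simp add: inv_mult_group)
    qed
    then show ?thesis
      using symmetric_on_conv_power[OF \<mu>, of k] xy z unfolding symmetric_on_def kernel_def
      by (metis inv_closed m_closed)
  qed
  have "ennreal (kernel \<mu> (j + k) x y)
      = (\<integral>\<^sup>+z. ennreal (pmf (conv_power G \<mu> j) z)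
          * ennreal (pmf (conv_power G \<mu> k) (inv z \<otimes> (inv x \<otimes> y))) \<partial>count_space (carrier G))"
    unfolding kernel_def conv_power_add[OF \<mu>(1)]
    using \<mu> xy by (intro pmf_conv prob_on_conv_power) auto
  also have "\<dots> = (\<integral>\<^sup>+z. ennreal (pmf (conv_power G \<mu> j) (inv x \<otimes> z))
      * ennreal (pmf (conv_power G \<mu> k) (inv (inv x \<otimes> z) \<otimes> (inv x \<otimes> y))) \<partial>count_space (carrier G))"
    using xy by (intro nn_integral_bij_count_space[symmetric] bij_betw_translate) auto
  also have "\<dots> = (\<integral>\<^sup>+z. ennreal (kernel \<mu> j x z) * ennreal (kernel \<mu> k y z) \<partial>count_space (carrier G))"
    by (intro nn_integral_cong) (simp add: sym, simp add: kernel_def)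
  finally show ?thesis .
qed

lemma kernel_diag: "x \<in> carrier G \<Longrightarrow> kernel \<mu> n x x = pmf (conv_power G \<mu> n) \<one>"
  by (simp add: kernel_def)

text \<open>Apply \<open>2 * a * b \<le> a ^ 2 + b ^ 2\<close> to the two rows in
  \<open>kernel_add\<close>; the two resulting diagonal values agree by translation
  invariance.\<close>

lemma kernel_le_diag:
  assumes \<mu>: "prob_on G \<mu>" "symmetric_on G \<mu>" and xy: "x \<in> carrier G" "y \<in> carrier G"
  shows "kernel \<mu> (2 * n) x y \<le> pmf (conv_power G \<mu> (2 * n)) \<one>"
proof -
  have "2 * ennreal (kernel \<mu> (n + n) x y)
      = (\<integral>\<^sup>+z. ennreal (2 * (kernel \<mu> n x z * kernel \<mu> n y z)) \<partial>count_space (carrier G))"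
    unfolding kernel_add[OF \<mu> xy]
    by (subst nn_integral_cmult[symmetric]) (auto simp: ennreal_mult kernel_nonneg)
  also have "\<dots> \<le> (\<integral>\<^sup>+z. ennreal (kernel \<mu> n x z * kernel \<mu> n x z)
      + ennreal (kernel \<mu> n y z * kernel \<mu> n y z) \<partial>count_space (carrier G))"
    using sum_squares_bound[of "kernel \<mu> n x z" "kernel \<mu> n y z" for z]
    by (intro nn_integral_mono) (simp add: kernel_nonneg power2_eq_square mult.assoc flip: ennreal_plus)
  also have "\<dots> = ennreal (kernel \<mu> (n + n) x x) + ennreal (kernel \<mu> (n + n) y y)"
    unfolding kernel_add[OF \<mu> xy(1) xy(1)] kernel_add[OF \<mu> xy(2) xy(2)]
    by (subst nn_integral_add) (auto simp: ennreal_mult kernel_nonneg)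
  also have "\<dots> = 2 * ennreal (pmf (conv_power G \<mu> (2 * n)) \<one>)"
    using xy by (simp add: kernel_diag flip: mult_2)
  finally have "ennreal (2 * kernel \<mu> (2 * n) x y) \<le> ennreal (2 * pmf (conv_power G \<mu> (2 * n)) \<one>)"
    by (simp add: ennreal_mult kernel_nonneg flip: mult_2)
  then show ?thesis by simp
qed

text \<open>The even power \<open>2 * n\<close> attains its maximum at the identity, and the
  remaining \<open>N - 2 * n\<close> convolutions, of either parity, cannot raise the
  supremum.\<close>

lemma return_prob_mono:
  assumes \<mu>: "prob_on G \<mu>" "symmetric_on G \<mu>" and "2 * n \<le> N"
  shows "pmf (conv_power G \<mu> N) \<one> \<le> pmf (conv_power G \<mu> (2 * n)) \<one>"
proof -
  have "pmf (conv G (conv_power G \<mu> (2 * n)) (conv_power G \<mu> (N - 2 * n))) \<one>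
      \<le> pmf (conv_power G \<mu> (2 * n)) \<one>"
  proof (rule pmf_conv_le)
    fix y assume "y \<in> carrier G"
    then show "pmf (conv_power G \<mu> (2 * n)) y \<le> pmf (conv_power G \<mu> (2 * n)) \<one>"
      using kernel_le_diag[OF \<mu>, of \<one> y n] by (simp add: kernel_def)
  qed (use \<mu> in \<open>auto intro: prob_on_conv_power\<close>)
  then show ?thesis
    using conv_power_add[OF \<mu>(1), of "2 * n" "N - 2 * n"] assms(3) by simp
qed

text \<open>Keep only the paths that are at the identity at time \<open>n\<close> and stay there in
  the last step. This bridges even and odd times.\<close>

lemma return_prob_Suc_ge:
  assumes \<mu>: "prob_on G \<mu>"
  shows "pmf (conv_power G \<mu> n) \<one> * pmf \<mu> \<one> \<le> pmf (conv_power G \<mu> (Suc n)) \<one>"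
proof -
  let ?f = "\<lambda>y. ennreal (pmf (conv_power G \<mu> n) y) * ennreal (pmf \<mu> (inv y \<otimes> \<one>))"
  have "ennreal (pmf (conv_power G \<mu> n) \<one> * pmf \<mu> \<one>) = ?f \<one>"
    by (simp add: ennreal_mult)
  also have "\<dots> = (\<integral>\<^sup>+y. ?f y * indicator {\<one>} y \<partial>count_space (carrier G))"
    by (subst nn_integral_indicator_singleton) auto
  also have "\<dots> \<le> (\<integral>\<^sup>+y. ?f y \<partial>count_space (carrier G))"
    by (intro nn_integral_mono) (auto simp: indicator_def)
  also have "\<dots> = ennreal (pmf (conv_power G \<mu> (Suc n)) \<one>)"
    using \<mu> by (simp add: pmf_conv prob_on_conv_power)
  finally show ?thesis by simp
qed

section \<open>Quadratic forms of the walk\<close>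

text \<open>The inner product of \<open>f\<close>, cut off to \<open>A\<close>, with its image under
  \<open>n\<close> steps of the walk.\<close>

definition qform :: "'a pmf \<Rightarrow> 'a set \<Rightarrow> ('a \<Rightarrow> real) \<Rightarrow> nat \<Rightarrow> real" where
  "qform \<mu> A f n = (\<Sum>x\<in>A. \<Sum>y\<in>A. f x * f y * kernel \<mu> n x y)"

context
  fixes \<mu> :: "'a pmf" and A :: "'a set" and f :: "'a \<Rightarrow> real"
  assumes \<mu>: "prob_on G \<mu>" "symmetric_on G \<mu>"
    and A: "finite A" "A \<subseteq> carrier G"
    and f: "\<And>x. x \<in> A \<Longrightarrow> 0 \<le> f x"
begin

lemma qform_nonneg: "0 \<le> qform \<mu> A f n"
  unfolding qform_def using f by (intro sum_nonneg mult_nonneg_nonneg kernel_nonneg)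

text \<open>The form as an inner product of \<open>f\<close> run for \<open>j\<close> steps with
  \<open>f\<close> run for \<open>k\<close> steps, so that Cauchy-Schwarz applies.\<close>

lemma qform_add:
  "ennreal (qform \<mu> A f (j + k))
    = (\<integral>\<^sup>+z. (\<Sum>x\<in>A. ennreal (f x) * ennreal (kernel \<mu> j x z))
        * (\<Sum>y\<in>A. ennreal (f y) * ennreal (kernel \<mu> k y z)) \<partial>count_space (carrier G))"
proof -
  have "(\<integral>\<^sup>+z. (\<Sum>x\<in>A. ennreal (f x) * ennreal (kernel \<mu> j x z))
        * (\<Sum>y\<in>A. ennreal (f y) * ennreal (kernel \<mu> k y z)) \<partial>count_space (carrier G))
    = (\<integral>\<^sup>+z. (\<Sum>x\<in>A. \<Sum>y\<in>A. ennreal (f x * f y) * (ennreal (kernel \<mu> j x z) * ennreal (kernel \<mu> k y z)))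
        \<partial>count_space (carrier G))"
    unfolding sum_product using f
    by (intro nn_integral_cong sum.cong refl) (simp add: ennreal_mult mult_ac)
  also have "\<dots> = (\<Sum>x\<in>A. \<Sum>y\<in>A. ennreal (f x * f y) * ennreal (kernel \<mu> (j + k) x y))"
    using A
    by (subst nn_integral_sum, simp, subst nn_integral_sum, simp)
       (auto intro!: sum.cong simp: nn_integral_cmult kernel_add[OF \<mu>] subset_eq)
  also have "\<dots> = (\<Sum>x\<in>A. \<Sum>y\<in>A. ennreal (f x * f y * kernel \<mu> (j + k) x y))"
    using f by (intro sum.cong refl) (simp add: ennreal_mult kernel_nonneg)
  also have "\<dots> = ennreal (qform \<mu> A f (j + k))"
    unfolding qform_def using f
    by (simp add: sum_ennreal sum_nonneg kernel_nonneg)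
  finally show ?thesis by simp
qed

lemma qform_Cauchy_Schwarz: "(qform \<mu> A f (j + k))\<^sup>2 \<le> qform \<mu> A f (2 * j) * qform \<mu> A f (2 * k)"
proof -
  have "(ennreal (qform \<mu> A f (j + k)))\<^sup>2 \<le> ennreal (qform \<mu> A f (j + j)) * ennreal (qform \<mu> A f (k + k))"
    unfolding qform_add power2_eq_square[of "sum _ _", symmetric]
    by (rule Cauchy_Schwarz_nn_integral) auto
  then have "ennreal ((qform \<mu> A f (j + k))\<^sup>2) \<le> ennreal (qform \<mu> A f (2 * j) * qform \<mu> A f (2 * k))"
    by (simp add: ennreal_mult qform_nonneg mult_2 ennreal_power)
  then show ?thesis by (simp add: qform_nonneg)
qed

lemma qform_0: "qform \<mu> A f 0 = (\<Sum>x\<in>A. (f x)\<^sup>2)"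
proof -
  have "kernel \<mu> 0 x y = (if x = y then 1 else 0)" if "x \<in> A" "y \<in> A" for x y
  proof -
    have "inv x \<otimes> y = \<one> \<longleftrightarrow> x = y"
      using that A inv_solve_left[of \<one> x y] by (auto simp: subset_eq)
    then show ?thesis by (auto simp: kernel_def indicator_def eq_commute[of \<one>] simp del: r_inv l_inv)
  qed
  then have "qform \<mu> A f 0 = (\<Sum>x\<in>A. \<Sum>y\<in>A. if x = y then f x * f y else 0)"
    unfolding qform_def by (intro sum.cong refl) auto
  also have "\<dots> = (\<Sum>x\<in>A. (f x)\<^sup>2)"
    using A by (simp add: sum.delta power2_eq_square)
  finally show ?thesis .
qed

text \<open>Replace every kernel value by the diagonal one and bound the square of the sum of
  \<open>f\<close> by \<open>card A\<close> times the sum of squares.\<close>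

lemma qform_le_return_prob:
  "qform \<mu> A f (2 * n) \<le> pmf (conv_power G \<mu> (2 * n)) \<one> * (card A * qform \<mu> A f 0)"
proof -
  let ?p = "pmf (conv_power G \<mu> (2 * n)) \<one>"
  have "qform \<mu> A f (2 * n) \<le> (\<Sum>x\<in>A. \<Sum>y\<in>A. f x * f y * ?p)"
    unfolding qform_def using A f
    by (intro sum_mono mult_left_mono kernel_le_diag \<mu>) (auto simp: subset_eq)
  also have "\<dots> = ?p * (\<Sum>x\<in>A. f x * 1)\<^sup>2"
    by (simp add: power2_eq_square sum_product sum_distrib_left sum_distrib_right mult_ac)
  also have "\<dots> \<le> ?p * ((\<Sum>x\<in>A. (f x)\<^sup>2) * (\<Sum>x\<in>A. 1\<^sup>2))"
    by (intro mult_left_mono Cauchy_Schwarz_ineq_sum) auto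
  finally show ?thesis by (simp add: qform_0 mult.commute)
qed

text \<open>By Cauchy--Schwarz the even moments of the quadratic form are log-convex.\<close>
lemma qform_power_le:
  assumes pos: "0 < qform \<mu> A f 0"
  shows "(qform \<mu> A f 1 / qform \<mu> A f 0) ^ (2 * n) * qform \<mu> A f 0 \<le> qform \<mu> A f (2 * n)"
proof (cases "qform \<mu> A f 1 = 0")
  case True
  then show ?thesis using pos qform_nonneg[of "2 * n"] by (cases n) auto
next
  case False
  define b where "b n = qform \<mu> A f (2 * n)" for n
  define r where "r = (qform \<mu> A f 1 / qform \<mu> A f 0)\<^sup>2"
  have r: "0 < r" using False pos by (simp add: r_def)
  \<comment> \<open>Log-convexity makes the consecutive ratios of \<open>b\<close> nondecreasing.
    Positivity, which rests on \<open>r > 0\<close>, is carried along so that a factor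
    \<open>b n\<close> can be cancelled.\<close>
  have step: "0 < b n \<and> r * b n \<le> b (Suc n)" for n
  proof (induction n)
    case 0
    have "(qform \<mu> A f 1)\<^sup>2 \<le> qform \<mu> A f 0 * qform \<mu> A f 2"
      using qform_Cauchy_Schwarz[of 0 1] by (simp add: numeral_2_eq_2)
    then show ?case using pos by (simp add: b_def r_def power_divide power2_eq_square numeral_2_eq_2 field_simps)
  next
    case (Suc n)
    have pos': "0 < b (Suc n)" using Suc r by (meson less_le_trans mult_pos_pos)
    have "(qform \<mu> A f (n + Suc (Suc n)))\<^sup>2 \<le> b n * b (Suc (Suc n))"
      unfolding b_def by (rule qform_Cauchy_Schwarz)
    then have "b (Suc n) * b (Suc n) \<le> b n * b (Suc (Suc n))"
      by (simp add: b_def power2_eq_square mult_2)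
    moreover have "r * b n * b (Suc n) \<le> b (Suc n) * b (Suc n)"
      using Suc pos' by (intro mult_right_mono) auto
    ultimately have "b n * (r * b (Suc n)) \<le> b n * b (Suc (Suc n))"
      by (simp add: mult_ac)
    then show ?case using Suc pos' by simp
  qed
  have "r ^ n * b 0 \<le> b n"
  proof (induction n)
    case (Suc n)
    have "r * (r ^ n * b 0) \<le> r * b n" using Suc r by (intro mult_left_mono) auto
    then show ?case using step[of n] by (simp add: mult.assoc)
  qed simp
  then show ?thesis by (simp add: b_def r_def power_mult)
qed

lemma return_prob_ge:
  assumes pos: "0 < qform \<mu> A f 0"
  shows "(qform \<mu> A f 1 / qform \<mu> A f 0) ^ (2 * n) \<le> pmf (conv_power G \<mu> (2 * n)) \<one> * card A"
proof -
  have "(qform \<mu> A f 1 / qform \<mu> A f 0) ^ (2 * n) * qform \<mu> A f 0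
      \<le> (pmf (conv_power G \<mu> (2 * n)) \<one> * card A) * qform \<mu> A f 0"
    using order_trans[OF qform_power_le[OF pos] qform_le_return_prob, of n] by (simp add: mult.assoc)
  then show ?thesis using pos by simp
qed

end

end

section \<open>Removing pieces of a measure\<close>

context group
begin

definition mass :: "('a \<Rightarrow> ennreal) \<Rightarrow> ennreal" where
  "mass f = (\<integral>\<^sup>+y. f y \<partial>count_space (carrier G))"

text \<open>Convolution powers of nonnegative functions of arbitrary mass: what remains of a pmf
  after a piece has been subtracted is no longer a pmf.\<close>

primrec npow :: "('a \<Rightarrow> ennreal) \<Rightarrow> nat \<Rightarrow> 'a \<Rightarrow> ennreal" where
  "npow f 0 = indicator {\<one>}"
| "npow f (Suc n) = (\<lambda>x. \<integral>\<^sup>+y. npow f n y * f (inv y \<otimes> x) \<partial>count_space (carrier G))"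

lemma npow_pmf:
  assumes \<mu>: "prob_on G \<mu>"
  shows "x \<in> carrier G \<Longrightarrow> npow (\<lambda>y. ennreal (pmf \<mu> y)) n x = ennreal (pmf (conv_power G \<mu> n) x)"
proof (induction n arbitrary: x)
  case 0
  then show ?case by (simp add: indicator_def)
next
  case (Suc n)
  then show ?case
    using \<mu> by (auto simp: pmf_conv prob_on_conv_power intro!: nn_integral_cong)
qed

text \<open>Tonelli and the translation invariance of counting measure split off one factor
  \<open>mass f\<close> per step.\<close>

lemma mass_npow_le: "mass (npow f n) \<le> mass f ^ n"
proof (induction n)
  case 0
  have "(\<integral>\<^sup>+y. 1 * indicator {\<one>} y \<partial>count_space (carrier G)) = 1"
    by (subst nn_integral_indicator_singleton) auto
  then show ?case by (simp add: mass_def)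
next
  case (Suc n)
  let ?C = "carrier G"
  let ?F = "\<lambda>(x, y). npow f n y * f (inv y \<otimes> x) * indicator ?C y * indicator ?C x"
  \<comment> \<open>Indicators move the integrals to \<open>count_space UNIV\<close>, where the
    order can be exchanged without countability of the carrier.\<close>
  have "mass (npow f (Suc n)) = (\<integral>\<^sup>+x. \<integral>\<^sup>+y. ?F (x, y) \<partial>count_space UNIV \<partial>count_space UNIV)"
    unfolding mass_def
    by (simp add: nn_integral_count_space_indicator nn_integral_multc)
  also have "\<dots> = (\<integral>\<^sup>+y. \<integral>\<^sup>+x. ?F (x, y) \<partial>count_space UNIV \<partial>count_space UNIV)"
    by (simp only: nn_integral_fst_count_space nn_integral_snd_count_space)
  also have "\<dots> = (\<integral>\<^sup>+y. npow f n y * (\<integral>\<^sup>+x. f (inv y \<otimes> x) \<partial>count_space ?C) \<partial>count_space ?C)"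
    by (simp add: nn_integral_count_space_indicator nn_integral_cmult[symmetric] nn_integral_multc[symmetric] mult_ac)
  also have "\<dots> = (\<integral>\<^sup>+y. npow f n y * mass f \<partial>count_space ?C)"
    unfolding mass_def
    by (intro nn_integral_cong arg_cong2[of _ _ _ _ "(*)"] refl nn_integral_bij_count_space bij_betw_translate)
       auto
  also have "\<dots> = mass (npow f n) * mass f"
    unfolding mass_def by (simp add: nn_integral_multc)
  also have "\<dots> \<le> mass f ^ Suc n"
    using Suc by (simp add: mult_right_mono mult.commute mult_left_mono)
  finally show ?case .
qed

lemma npow_le: "x \<in> carrier G \<Longrightarrow> npow f n x \<le> mass f ^ n"
proof -
  assume x: "x \<in> carrier G"
  have "npow f n x = (\<integral>\<^sup>+y. npow f n y * indicator {x} y \<partial>count_space (carrier G))"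
    using x by (subst nn_integral_indicator_singleton) auto
  also have "\<dots> \<le> mass (npow f n)"
    unfolding mass_def by (intro nn_integral_mono) (auto simp: indicator_def)
  finally show ?thesis using mass_npow_le order_trans by blast
qed

text \<open>Expand \<open>p\<^sup>n - q\<^sup>n\<close> as a telescoping sum: each summand contains one factor \<open>r = p - q\<close>, whose
  supremum bounds that of the whole product.\<close>
lemma npow_perturb:
  assumes pq: "\<And>y. y \<in> carrier G \<Longrightarrow> p y = q y + r y"
    and r: "\<And>y. y \<in> carrier G \<Longrightarrow> r y \<le> ennreal c"
    and P: "mass p = ennreal P" and Q: "mass q = ennreal Q"
    and c: "0 \<le> c" "0 < V" "0 \<le> Q" "P = Q + c * V"
  shows "x \<in> carrier G \<Longrightarrow> npow p n x \<le> npow q n x + ennreal ((P ^ n - Q ^ n) / V)"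
proof (induction n arbitrary: x)
  case (Suc n)
  let ?C = "count_space (carrier G)"
  define d where "d = (P ^ n - Q ^ n) / V"
  have PQ: "0 \<le> P" "Q \<le> P" using c by (auto simp: mult_nonneg_nonneg)
  have d: "0 \<le> d" using c PQ by (auto simp: d_def power_mono)
  have x: "x \<in> carrier G" by fact
  have trans: "(\<integral>\<^sup>+y. p (inv y \<otimes> x) \<partial>?C) = ennreal P"
    using nn_integral_bij_count_space[OF bij_betw_translate_inv[OF x], of p] P by (simp add: mass_def)
  have "npow p (Suc n) x \<le> (\<integral>\<^sup>+y. (npow q n y + ennreal d) * p (inv y \<otimes> x) \<partial>?C)"
    using Suc.IH by (auto intro!: nn_integral_mono mult_right_mono simp: d_def)
  also have "\<dots> = (\<integral>\<^sup>+y. npow q n y * q (inv y \<otimes> x) + npow q n y * r (inv y \<otimes> x)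
      + ennreal d * p (inv y \<otimes> x) \<partial>?C)"
    using x by (intro nn_integral_cong) (simp add: pq distrib_left distrib_right)
  also have "\<dots> = npow q (Suc n) x + (\<integral>\<^sup>+y. npow q n y * r (inv y \<otimes> x) \<partial>?C) + ennreal d * ennreal P"
    by (simp add: nn_integral_add nn_integral_cmult trans)
  also have "(\<integral>\<^sup>+y. npow q n y * r (inv y \<otimes> x) \<partial>?C) \<le> (\<integral>\<^sup>+y. npow q n y * ennreal c \<partial>?C)"
    using x r by (intro nn_integral_mono mult_left_mono) auto
  also have "\<dots> = mass (npow q n) * ennreal c"
    by (simp add: mass_def nn_integral_multc)
  also have "\<dots> \<le> ennreal (Q ^ n) * ennreal c"
    using mass_npow_le[of q n] c by (intro mult_right_mono) (auto simp: Q ennreal_power)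
  also have "npow q (Suc n) x + ennreal (Q ^ n) * ennreal c + ennreal d * ennreal P
      = npow q (Suc n) x + ennreal (Q ^ n * c + d * P)"
    using c PQ d by (simp add: ennreal_mult add.assoc)
  \<comment> \<open>As \<open>c * V = P - Q\<close>, multiplying by \<open>V\<close> gives
    \<open>Q ^ n * (P - Q) + (P ^ n - Q ^ n) * P\<close>, which telescopes.\<close>
  also have "Q ^ n * c + d * P = (P ^ Suc n - Q ^ Suc n) / V"
    using c(2) by (simp add: d_def c(4) field_simps)
  finally show ?case by (simp add: add_mono)
qed simp

text \<open>Let \<open>\<nu> k\<close> be \<open>\<mu>\<close> with all pieces of index at least
  \<open>k\<close> removed, a function of mass \<open>m k\<close>. Restore the pieces one at a time:
  step \<open>k\<close> adds the products whose largest piece index is \<open>k\<close>, of total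
  mass \<open>m (Suc k) ^ n - m k ^ n\<close>, and each contains a factor uniform on
  \<open>B k\<close>, hence the division by \<open>card (B k)\<close>.\<close>

lemma return_prob_le_sum:
  fixes c :: "nat \<Rightarrow> real" and B :: "nat \<Rightarrow> 'a set"
  assumes \<mu>: "prob_on G \<mu>" and c: "\<And>j. 0 \<le> c j"
    and B: "\<And>j. finite (B j)" "\<And>j. B j \<subseteq> carrier G" "\<And>j. B j \<noteq> {}"
    and le: "\<And>g. g \<in> carrier G \<Longrightarrow> (\<Sum>j<K. c j * indicator (B j) g) \<le> pmf \<mu> g"
  defines "m \<equiv> \<lambda>k. 1 - (\<Sum>j\<in>{k..<K}. c j * card (B j))"
  shows "pmf (conv_power G \<mu> n) \<one> \<le> m 0 ^ n + (\<Sum>k<K. (m (Suc k) ^ n - m k ^ n) / card (B k))"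
    and "0 \<le> m 0"
proof -
  define s where "s k g = (\<Sum>j\<in>{k..<K}. c j * indicator (B j) g)" for k g
  define \<nu> where "\<nu> k g = pmf \<mu> g - s k g" for k g
  have s0: "0 \<le> s k g" for k g
    unfolding s_def using c by (intro sum_nonneg) auto
  have s_le: "s k g \<le> pmf \<mu> g" if "g \<in> carrier G" for k g
  proof -
    have "s k g \<le> (\<Sum>j<K. c j * indicator (B j) g)"
      unfolding s_def using c by (intro sum_mono2) auto
    then show ?thesis using le[OF that] by simp
  qed
  have mass_s: "(\<integral>\<^sup>+g. ennreal (s k g) \<partial>count_space (carrier G)) = ennreal (1 - m k)" for k
  proof -
    have "(\<integral>\<^sup>+g. ennreal (s k g) \<partial>count_space (carrier G))
        = (\<integral>\<^sup>+g. (\<Sum>j\<in>{k..<K}. ennreal (c j) * indicator (B j) g) \<partial>count_space (carrier G))"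
    proof (intro nn_integral_cong)
      fix g
      have "ennreal (s k g) = (\<Sum>j\<in>{k..<K}. ennreal (c j * indicator (B j) g))"
        unfolding s_def using c by (intro sum_ennreal[symmetric]) auto
      moreover have "ennreal (c j * indicator (B j) g) = ennreal (c j) * indicator (B j) g" for j
        by (cases "g \<in> B j") auto
      ultimately show "ennreal (s k g) = (\<Sum>j\<in>{k..<K}. ennreal (c j) * indicator (B j) g)"
        by simp
    qed
    also have "\<dots> = (\<Sum>j\<in>{k..<K}. ennreal (c j) * ennreal (card (B j)))"
      using B by (subst nn_integral_sum)
        (auto simp: nn_integral_cmult_indicator emeasure_count_space_finite ennreal_of_nat_eq_real_of_nat)
    also have "\<dots> = ennreal (1 - m k)"
      unfolding m_def using c by (simp add: ennreal_mult[symmetric] sum_ennreal)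
    finally show ?thesis .
  qed
  have tot: "mass (\<lambda>g. ennreal (\<nu> k g)) + ennreal (1 - m k) = 1" for k
  proof -
    have "mass (\<lambda>g. ennreal (\<nu> k g)) + ennreal (1 - m k)
        = (\<integral>\<^sup>+g. ennreal (\<nu> k g) + ennreal (s k g) \<partial>count_space (carrier G))"
      unfolding mass_s[symmetric] mass_def by (intro nn_integral_add[symmetric]) auto
    also have "\<dots> = (\<integral>\<^sup>+g. ennreal (pmf \<mu> g) \<partial>count_space (carrier G))"
      using s0 s_le by (intro nn_integral_cong) (simp add: \<nu>_def flip: ennreal_plus)
    also have "\<dots> = 1"
      unfolding nn_integral_pmf using \<mu>
      by (intro measure_pmf.emeasure_eq_1_AE) (auto simp: prob_on_def AE_measure_pmf_iff)
    finally show ?thesis .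
  qed
  have sm0: "0 \<le> 1 - m k" for k
    unfolding m_def using c by (simp add: sum_nonneg)
  have m0: "0 \<le> m k" for k
  proof -
    have "ennreal (1 - m k) \<le> mass (\<lambda>g. ennreal (\<nu> k g)) + ennreal (1 - m k)"
      by (rule add_increasing) auto
    then have "ennreal (1 - m k) \<le> ennreal 1" unfolding tot by simp
    then show ?thesis by (simp add: ennreal_le_iff)
  qed
  have mass_\<nu>: "mass (\<lambda>g. ennreal (\<nu> k g)) = ennreal (m k)" for k
  proof -
    have "mass (\<lambda>g. ennreal (\<nu> k g)) = 1 - ennreal (1 - m k)"
      unfolding tot[of k, symmetric] by simp
    also have "\<dots> = ennreal (m k)"
      using m0 sm0 by (simp add: ennreal_minus flip: ennreal_1)
    finally show ?thesis .
  qed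
  have card: "0 < card (B k)" for k using B by (simp add: card_gt_0_iff)
  have step: "npow (\<lambda>g. ennreal (\<nu> (Suc k) g)) n \<one>
      \<le> npow (\<lambda>g. ennreal (\<nu> k g)) n \<one> + ennreal ((m (Suc k) ^ n - m k ^ n) / card (B k))"
    if "k < K" for k
  proof (rule npow_perturb[where r = "\<lambda>g. ennreal (c k * indicator (B k) g)" and c = "c k"])
    show "ennreal (\<nu> (Suc k) y) = ennreal (\<nu> k y) + ennreal (c k * indicator (B k) y)"
      if "y \<in> carrier G" for y
    proof -
      have "\<nu> (Suc k) y = \<nu> k y + c k * indicator (B k) y"
        unfolding \<nu>_def s_def sum.atLeast_Suc_lessThan[OF \<open>k < K\<close>] by linarith
      moreover have "0 \<le> c k * indicator (B k) y" using c by simp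
      moreover have "0 \<le> \<nu> k y" using s_le[OF that, of k] by (simp add: \<nu>_def)
      ultimately show ?thesis by (simp only: ennreal_plus)
    qed
    show "ennreal (c k * indicator (B k) y) \<le> ennreal (c k)" for y
      using c by (intro ennreal_leI) (auto simp: indicator_def)
    show "m (Suc k) = m k + c k * real (card (B k))"
      using \<open>k < K\<close> by (simp add: m_def sum.atLeast_Suc_lessThan)
  qed (use c m0 card in \<open>auto simp: mass_\<nu>\<close>)
  have mono: "m k \<le> m (Suc k)" for k
    unfolding m_def using c by (cases "k < K") (auto simp: sum.atLeast_Suc_lessThan)
  then have inc: "0 \<le> (m (Suc k) ^ n - m k ^ n) / card (B k)" for k
    using m0 by (simp add: power_mono)
  have "j \<le> K \<Longrightarrow> npow (\<lambda>g. ennreal (\<nu> j g)) n \<one>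
      \<le> ennreal (m 0 ^ n + (\<Sum>k<j. (m (Suc k) ^ n - m k ^ n) / card (B k)))" for j
  proof (induction j)
    case 0
    show ?case
      using npow_le[OF one_closed, of "\<lambda>g. ennreal (\<nu> 0 g)" n] m0 by (simp add: mass_\<nu> ennreal_power)
  next
    case (Suc j)
    have "npow (\<lambda>g. ennreal (\<nu> (Suc j) g)) n \<one>
        \<le> ennreal (m 0 ^ n + (\<Sum>k<j. (m (Suc k) ^ n - m k ^ n) / card (B k)))
          + ennreal ((m (Suc j) ^ n - m j ^ n) / card (B j))"
      using Suc order_trans[OF step[of j] add_right_mono] by simp
    also have "\<dots> = ennreal (m 0 ^ n + (\<Sum>k<Suc j. (m (Suc k) ^ n - m k ^ n) / card (B k)))"
      using m0 inc by (subst ennreal_plus[symmetric]) (auto intro!: add_nonneg_nonneg sum_nonneg simp: add.assoc)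
    finally show ?case .
  qed
  from this[of K] have "ennreal (pmf (conv_power G \<mu> n) \<one>)
      \<le> ennreal (m 0 ^ n + (\<Sum>k<K. (m (Suc k) ^ n - m k ^ n) / card (B k)))"
    using npow_pmf[OF \<mu> one_closed, of n] by (simp add: \<nu>_def s_def)
  then show "pmf (conv_power G \<mu> n) \<one> \<le> m 0 ^ n + (\<Sum>k<K. (m (Suc k) ^ n - m k ^ n) / card (B k))"
    using m0 inc by (subst (asm) ennreal_le_iff) (auto intro!: add_nonneg_nonneg sum_nonneg)
  show "0 \<le> m 0" by (rule m0)
qed

end

section \<open>The word metric\<close>

locale word_metric = group G for G (structure) +
  fixes S :: "'a list"
  assumes gen: "gen_tuple G S"
begin

section \<open>Words, lengths and balls\<close>

abbreviation len :: "'a \<Rightarrow> nat" where "len \<equiv> word_length G S"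

definition ball :: "nat \<Rightarrow> 'a set" where "ball r = {g \<in> carrier G. len g \<le> r}"

definition word_prod :: "'a list \<Rightarrow> 'a" where
  "word_prod w = foldr (\<lambda>x y. x \<otimes> y) w \<one>"

lemma word_prod_simps [simp]: "word_prod [] = \<one>" "word_prod (x # w) = x \<otimes> word_prod w"
  by (simp_all add: word_prod_def)

lemma sym_gens_closed: "sym_gens G S \<subseteq> carrier G"
  using gen by (auto simp: sym_gens_def gen_tuple_def)

lemma word_prod_closed: "set w \<subseteq> sym_gens G S \<Longrightarrow> word_prod w \<in> carrier G"
  using sym_gens_closed by (induction w) auto

lemma word_prod_append:
  "set v \<subseteq> sym_gens G S \<Longrightarrow> set w \<subseteq> sym_gens G S \<Longrightarrow> word_prod (v @ w) = word_prod v \<otimes> word_prod w"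
proof (induction v)
  case (Cons x v)
  then show ?case using sym_gens_closed by (auto simp: m_assoc word_prod_closed)
qed (simp add: word_prod_closed)

lemma sym_gens_inv: "x \<in> sym_gens G S \<Longrightarrow> inv x \<in> sym_gens G S"
  using gen by (auto simp: sym_gens_def gen_tuple_def)

lemma word_prod_rev_inv:
  "set w \<subseteq> sym_gens G S \<Longrightarrow> word_prod (rev (map (\<lambda>x. inv x) w)) = inv (word_prod w)"
proof (induction w)
  case (Cons x w)
  have "set (rev (map (\<lambda>x. inv x) w)) \<subseteq> sym_gens G S" "set [inv x] \<subseteq> sym_gens G S"
    using Cons.prems sym_gens_inv by auto
  then show ?case
    using Cons sym_gens_closed by (auto simp: word_prod_append inv_mult_group word_prod_closed)
qed simp

lemma word_exists:
  assumes "g \<in> carrier G"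
  shows "\<exists>w. set w \<subseteq> sym_gens G S \<and> g = word_prod w"
proof -
  have S: "set S \<subseteq> carrier G" "g \<in> generate G (set S)"
    using assms gen by (auto simp: gen_tuple_def)
  from S(2) show ?thesis
  proof (induction rule: generate.induct)
    case one
    show ?case by (rule exI[of _ "[]"]) simp
  next
    case (incl h)
    then show ?case using S by (intro exI[of _ "[h]"]) (auto simp: sym_gens_def)
  next
    case (inv h)
    then show ?case using S by (intro exI[of _ "[inv h]"]) (auto simp: sym_gens_def)
  next
    case (eng g h)
    then obtain v w where "set v \<subseteq> sym_gens G S" "g = word_prod v" "set w \<subseteq> sym_gens G S" "h = word_prod w"
      by auto
    then show ?case by (intro exI[of _ "v @ w"]) (auto simp: word_prod_append)
  qed
qed

lemma word_length_le: "set w \<subseteq> sym_gens G S \<Longrightarrow> len (word_prod w) \<le> length w"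
  unfolding word_length_def word_prod_def by (rule Least_le) auto

lemma word_length_witness:
  assumes "g \<in> carrier G"
  obtains w where "set w \<subseteq> sym_gens G S" "g = word_prod w" "length w = len g"
proof -
  have "\<exists>m w. length w = m \<and> set w \<subseteq> sym_gens G S \<and> g = word_prod w"
    using word_exists[OF assms] by auto
  from LeastI_ex[OF this] show ?thesis
    using that unfolding word_length_def word_prod_def by blast
qed

lemma word_length_mult:
  assumes "g \<in> carrier G" "h \<in> carrier G"
  shows "len (g \<otimes> h) \<le> len g + len h"
proof -
  obtain v w where "set v \<subseteq> sym_gens G S" "g = word_prod v" "length v = len g"
    "set w \<subseteq> sym_gens G S" "h = word_prod w" "length w = len h"
    using word_length_witness assms by metis
  then show ?thesis using word_length_le[of "v @ w"] by (simp add: word_prod_append)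
qed

lemma word_length_inv_le:
  assumes "g \<in> carrier G"
  shows "len (inv g) \<le> len g"
proof -
  obtain w where "set w \<subseteq> sym_gens G S" "g = word_prod w" "length w = len g"
    using word_length_witness assms by metis
  then show ?thesis
    using word_length_le[of "rev (map (\<lambda>x. inv x) w)"] sym_gens_inv
    by (simp add: word_prod_rev_inv image_subset_iff subset_eq)
qed

lemma word_length_one: "len \<one> = 0"
  using word_length_le[of "[]"] by simp

lemma finite_ball: "finite (ball r)"
proof (rule finite_subset)
  show "ball r \<subseteq> word_prod ` {w. set w \<subseteq> sym_gens G S \<and> length w \<le> r}"
  proof
    fix g assume "g \<in> ball r"
    then show "g \<in> word_prod ` {w. set w \<subseteq> sym_gens G S \<and> length w \<le> r}"
      using word_length_witness[of g] by (force simp: ball_def)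
  qed
  have "finite (sym_gens G S)" by (simp add: sym_gens_def)
  then show "finite (word_prod ` {w. set w \<subseteq> sym_gens G S \<and> length w \<le> r})"
    by (intro finite_imageI finite_lists_length_le)
qed

lemma ball_subset: "ball r \<subseteq> carrier G" by (auto simp: ball_def)

lemma one_in_ball: "\<one> \<in> ball r" by (simp add: ball_def word_length_one)

lemma card_ball_pos: "0 < card (ball r)"
  using finite_ball one_in_ball by (auto simp: card_gt_0_iff)

lemma card_ball_mono: "r \<le> r' \<Longrightarrow> card (ball r) \<le> card (ball r')"
  by (intro card_mono finite_ball) (auto simp: ball_def)

lemma volume_eq: "volume G S n = card (ball n)"
  by (simp add: volume_def ball_def)

section \<open>Tent functions and the truncated second moment\<close>

text \<open>Subtraction on naturals truncates at 0, so the cone vanishes outside the ball of radius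
  \<open>r\<close>.\<close>

definition tent :: "nat \<Rightarrow> 'a \<Rightarrow> real" where "tent r g = real (r - len g)"

text \<open>The tent is 1-Lipschitz in the word metric and has values between 0 and
  \<open>r\<close>; these two facts give the two arguments of \<open>min\<close>.\<close>

lemma tent_diff:
  assumes "x \<in> carrier G" "y \<in> carrier G"
  shows "\<bar>tent r (x \<otimes> y) - tent r x\<bar> \<le> real (min (len y) r)"
proof -
  have "len (x \<otimes> y) \<le> len x + len y"
    using assms by (rule word_length_mult)
  moreover have "len x \<le> len (x \<otimes> y) + len (inv y)"
    using word_length_mult[of "x \<otimes> y" "inv y"] assms by (simp add: m_assoc)
  moreover have "len (inv y) \<le> len y"
    using assms by (intro word_length_inv_le)
  ultimately show ?thesis by (simp add: tent_def)
qed

lemma tent_eq_0: "g \<in> carrier G \<Longrightarrow> g \<notin> ball r \<Longrightarrow> tent r g = 0"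
  by (simp add: tent_def ball_def)

text \<open>Polarize: twice the sum of products is the two sums of squares minus the sum of squared
  differences. All sums run over the union of the ball and its translate, so that both sums of
  squares equal the one over the ball; the union has at most twice as many points, and this 2
  cancels the one from polarization.\<close>

lemma sum_tent_translate:
  assumes y: "y \<in> carrier G"
  shows "(\<Sum>x\<in>ball r. (tent r x)\<^sup>2) - real (card (ball r)) * (real (min (len y) r))\<^sup>2
    \<le> (\<Sum>x\<in>ball r. tent r x * tent r (x \<otimes> y))"
proof -
  define T where "T = (\<lambda>x. x \<otimes> inv y) ` ball r"
  define U where "U = ball r \<union> T"
  have fin: "finite U" "finite T" by (auto simp: U_def T_def finite_ball)
  have UG: "U \<subseteq> carrier G" using ball_subset y by (auto simp: U_def T_def)
  have inj: "inj_on (\<lambda>x. x \<otimes> inv y) (ball r)"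
    using ball_subset y by (auto simp: inj_on_def subset_eq)
  have cardU: "card U \<le> 2 * card (ball r)"
    unfolding U_def using card_Un_le[of "ball r" T] card_image[OF inj] by (simp add: T_def)
  have s1: "(\<Sum>x\<in>U. (tent r x)\<^sup>2) = (\<Sum>x\<in>ball r. (tent r x)\<^sup>2)"
    using UG fin by (intro sum.mono_neutral_right) (auto simp: U_def tent_eq_0)
  have "(\<Sum>x\<in>U. (tent r (x \<otimes> y))\<^sup>2) = (\<Sum>x\<in>T. (tent r (x \<otimes> y))\<^sup>2)"
  proof (intro sum.mono_neutral_right fin ballI)
    fix x assume x: "x \<in> U - T"
    then have xG: "x \<in> carrier G" using UG by auto
    have "x \<otimes> y \<notin> ball r"
    proof
      assume "x \<otimes> y \<in> ball r"
      then have "x \<otimes> y \<otimes> inv y \<in> T" by (auto simp: T_def)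
      then show False using x xG y by (simp add: m_assoc)
    qed
    then show "(tent r (x \<otimes> y))\<^sup>2 = 0" using xG y by (simp add: tent_eq_0)
  qed (auto simp: U_def)
  also have "\<dots> = (\<Sum>x\<in>ball r. (tent r x)\<^sup>2)"
    unfolding T_def using ball_subset y
    by (subst sum.reindex[OF inj]) (auto intro!: sum.cong simp: m_assoc subset_eq)
  finally have s2: "(\<Sum>x\<in>U. (tent r (x \<otimes> y))\<^sup>2) = (\<Sum>x\<in>ball r. (tent r x)\<^sup>2)" .
  have "(\<Sum>x\<in>U. (tent r (x \<otimes> y) - tent r x)\<^sup>2) \<le> (\<Sum>x\<in>U. (real (min (len y) r))\<^sup>2)"
    using UG y tent_diff by (intro sum_mono) (auto simp: abs_le_square_iff[symmetric] subset_eq)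
  also have "\<dots> \<le> 2 * (real (card (ball r)) * (real (min (len y) r))\<^sup>2)"
    using mult_right_mono[of "real (card U)" "2 * real (card (ball r))" "(real (min (len y) r))\<^sup>2"] cardU
    by simp
  finally have s3: "(\<Sum>x\<in>U. (tent r (x \<otimes> y) - tent r x)\<^sup>2)
      \<le> 2 * (real (card (ball r)) * (real (min (len y) r))\<^sup>2)" .
  have "(\<Sum>x\<in>U. (tent r (x \<otimes> y) - tent r x)\<^sup>2)
      = (\<Sum>x\<in>U. (tent r (x \<otimes> y))\<^sup>2) + (\<Sum>x\<in>U. (tent r x)\<^sup>2) - 2 * (\<Sum>x\<in>U. tent r x * tent r (x \<otimes> y))"
    by (simp add: power2_diff sum.distrib sum_subtractf sum_distrib_left mult_ac)
  moreover have "(\<Sum>x\<in>U. tent r x * tent r (x \<otimes> y)) = (\<Sum>x\<in>ball r. tent r x * tent r (x \<otimes> y))"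
    using UG fin by (intro sum.mono_neutral_right) (auto simp: U_def tent_eq_0)
  ultimately show ?thesis using s1 s2 s3 by simp
qed

text \<open>Average the translation estimate over \<open>y\<close> of law \<open>\<psi>\<close>: the
  mean of the products is the one-step quadratic form. Truncation at \<open>r\<close> keeps every
  term integrable.\<close>

lemma qform_tent_ge:
  assumes \<psi>: "prob_on G \<psi>" "symmetric_on G \<psi>"
  shows "qform \<psi> (ball r) (tent r) 0
      - real (card (ball r)) * measure_pmf.expectation \<psi> (\<lambda>y. (real (min (len y) r))\<^sup>2)
    \<le> qform \<psi> (ball r) (tent r) 1"
proof -
  let ?E = "measure_pmf.expectation \<psi>"
  have q0: "qform \<psi> (ball r) (tent r) 0 = (\<Sum>x\<in>ball r. (tent r x)\<^sup>2)"
    using \<psi> finite_ball ball_subset by (rule qform_0) (simp add: tent_def)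
  have tb: "\<bar>tent r g\<bar> \<le> real r" for g by (simp add: tent_def)
  have int: "integrable (measure_pmf \<psi>) (\<lambda>y. tent r (x \<otimes> y))" for x
    using tb by (intro measure_pmf.integrable_const_bound[where B = "real r"]) auto
  have int2: "integrable (measure_pmf \<psi>) (\<lambda>y. (real (min (len y) r))\<^sup>2)"
    by (intro measure_pmf.integrable_const_bound[where B = "(real r)\<^sup>2"]) (auto intro!: power_mono)
  have k1: "kernel \<psi> 1 x y = pmf \<psi> (inv x \<otimes> y)" for x y
    using \<psi>(1) by (simp add: kernel_def conv_return_left)
  have E: "?E (\<lambda>y. tent r (x \<otimes> y)) = (\<Sum>y\<in>ball r. tent r y * kernel \<psi> 1 x y)" if x: "x \<in> ball r" for x
  proof -
    have xG: "x \<in> carrier G" using x ball_subset by auto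
    have inj: "inj_on (\<lambda>y. inv x \<otimes> y) (ball r)"
      using ball_subset xG by (auto simp: inj_on_def subset_eq)
    have "?E (\<lambda>y. tent r (x \<otimes> y)) = (\<Sum>y\<in>(\<lambda>y. inv x \<otimes> y) ` ball r. tent r (x \<otimes> y) * pmf \<psi> y)"
    proof (rule integral_measure_pmf_real)
      fix y assume y: "y \<in> set_pmf \<psi>" "tent r (x \<otimes> y) \<noteq> 0"
      have yG: "y \<in> carrier G" using y \<psi> by (auto simp: prob_on_def)
      have "x \<otimes> y \<in> ball r" using y xG yG tent_eq_0[of "x \<otimes> y" r] by auto
      moreover have "y = inv x \<otimes> (x \<otimes> y)" using xG yG by (simp add: m_assoc[symmetric])
      ultimately show "y \<in> (\<lambda>y. inv x \<otimes> y) ` ball r" by (rule rev_image_eqI)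
    qed (simp add: finite_ball)
    also have "\<dots> = (\<Sum>y\<in>ball r. tent r y * kernel \<psi> 1 x y)"
      using ball_subset xG
      by (subst sum.reindex[OF inj]) (auto intro!: sum.cong simp: k1[simplified] m_assoc[symmetric] subset_eq)
    finally show ?thesis .
  qed
  have "qform \<psi> (ball r) (tent r) 0 - real (card (ball r)) * ?E (\<lambda>y. (real (min (len y) r))\<^sup>2)
      = ?E (\<lambda>y. (\<Sum>x\<in>ball r. (tent r x)\<^sup>2) - real (card (ball r)) * (real (min (len y) r))\<^sup>2)"
    using int2 by (subst Bochner_Integration.integral_diff) (auto simp: q0)
  also have "\<dots> \<le> ?E (\<lambda>y. \<Sum>x\<in>ball r. tent r x * tent r (x \<otimes> y))"
    using \<psi> int int2
    by (intro integral_mono_AE AE_pmfI sum_tent_translate) (auto simp: prob_on_def)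
  also have "\<dots> = (\<Sum>x\<in>ball r. tent r x * ?E (\<lambda>y. tent r (x \<otimes> y)))"
    using int by (subst Bochner_Integration.integral_sum) auto
  also have "\<dots> = qform \<psi> (ball r) (tent r) 1"
    unfolding qform_def by (intro sum.cong refl) (simp add: E sum_distrib_left mult.assoc del: One_nat_def)
  finally show ?thesis .
qed

text \<open>If \<open>i\<close> is the largest index up to \<open>k\<close> with
  \<open>2 ^ i \<le> m\<close>, the minimum is at most \<open>2 * 2 ^ i\<close>, so the term of
  index \<open>i\<close> alone suffices.\<close>

lemma min_square_le_sum_indicator:
  "(real (min m (2 ^ k)))\<^sup>2 \<le> 4 * (\<Sum>i\<le>k. 4 ^ i * (if 2 ^ i \<le> m then 1 else 0))"
proof (cases "m = 0")
  case False
  then have ex: "2 ^ 0 \<le> m" by simp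
  define i where "i = (GREATEST i. i \<le> k \<and> 2 ^ i \<le> m)"
  have i: "i \<le> k \<and> 2 ^ i \<le> m"
    unfolding i_def by (rule GreatestI_nat[of _ 0 k]) (use ex in auto)
  have "min m (2 ^ k) \<le> 2 * 2 ^ i"
  proof (rule ccontr)
    assume *: "\<not> ?thesis"
    then have "Suc i \<le> k \<and> 2 ^ Suc i \<le> m"
      using i by (cases "i = k") auto
    then have "Suc i \<le> i"
      unfolding i_def by (intro Greatest_le_nat[where b = k]) auto
    then show False by simp
  qed
  then have "real (min m (2 ^ k)) \<le> 2 * 2 ^ i"
    by (metis of_nat_le_iff of_nat_mult of_nat_numeral of_nat_power)
  then have "(real (min m (2 ^ k)))\<^sup>2 \<le> (2 * 2 ^ i)\<^sup>2"
    by (intro power_mono) auto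
  also have "\<dots> = 4 * 4 ^ i"
    by (simp add: power_mult_distrib power_mult[symmetric] mult.commute[of i]) (simp add: power_mult)
  also have "\<dots> = 4 * (\<Sum>j\<in>{i}. 4 ^ j * (if 2 ^ j \<le> m then 1 else 0))"
    using i by simp
  also have "\<dots> \<le> 4 * (\<Sum>i\<le>k. 4 ^ i * (if 2 ^ i \<le> m then 1 else 0))"
    using i by (intro mult_left_mono sum_mono2) auto
  finally show ?thesis .
qed (simp add: sum_nonneg)

lemma expectation_min_square_le:
  assumes \<psi>: "prob_on G \<psi>"
  shows "measure_pmf.expectation \<psi> (\<lambda>y. (real (min (len y) (2 ^ k)))\<^sup>2)
    \<le> 4 * (\<Sum>i\<le>k. 4 ^ i * measure_pmf.prob \<psi> {g \<in> carrier G. 2 ^ i \<le> len g})"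
proof -
  let ?I = "\<lambda>i. indicator {g \<in> carrier G. 2 ^ i \<le> len g} :: 'a \<Rightarrow> real"
  have int: "integrable (measure_pmf \<psi>) (\<lambda>y. 4 ^ i * ?I i y)" for i
    by (intro measure_pmf.integrable_const_bound[where B = "4 ^ i"]) (auto simp: indicator_def)
  have "measure_pmf.expectation \<psi> (\<lambda>y. (real (min (len y) (2 ^ k)))\<^sup>2)
      \<le> measure_pmf.expectation \<psi> (\<lambda>y. 4 * (\<Sum>i\<le>k. 4 ^ i * ?I i y))"
  proof (intro integral_mono_AE AE_pmfI)
    show "integrable (measure_pmf \<psi>) (\<lambda>y. (real (min (len y) (2 ^ k)))\<^sup>2)"
      by (intro measure_pmf.integrable_const_bound[where B = "(real (2 ^ k))\<^sup>2"]) (auto intro!: power_mono)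
    show "integrable (measure_pmf \<psi>) (\<lambda>y. 4 * (\<Sum>i\<le>k. 4 ^ i * ?I i y))"
      by (intro integrable_mult_right Bochner_Integration.integrable_sum int)
    fix y assume "y \<in> set_pmf \<psi>"
    then have "y \<in> carrier G" using \<psi> by (auto simp: prob_on_def)
    then have eq: "?I i y = (if 2 ^ i \<le> len y then 1 else 0)" for i
      by simp
    show "(real (min (len y) (2 ^ k)))\<^sup>2 \<le> 4 * (\<Sum>i\<le>k. 4 ^ i * ?I i y)"
      unfolding eq by (rule min_square_le_sum_indicator)
  qed
  also have "\<dots> = 4 * (\<Sum>i\<le>k. 4 ^ i * measure_pmf.prob \<psi> {g \<in> carrier G. 2 ^ i \<le> len g})"
    unfolding integral_mult_right_zero Bochner_Integration.integral_sum[OF int] by simp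
  finally show ?thesis .
qed

end

section \<open>Two-sided bounds on return probabilities\<close>

locale growth_setup = word_metric G S + slow_weight l
  for G (structure) and S :: "'a list" and l :: "real \<Rightarrow> real" +
  fixes D :: real
  assumes growth: "poly_growth G S D"
begin

section \<open>Ball volumes at dyadic radii\<close>

definition Q :: real where "Q = 2 powr D"

definition dyad :: "nat \<Rightarrow> 'a set" where "dyad k = ball (2 ^ k)"

lemma Q_pos: "0 < Q" by (simp add: Q_def)

lemma Q_power: "Q ^ k = (2 ^ k) powr D"
  unfolding Q_def by (simp add: powr_power powr_powr powr_realpow[symmetric] mult.commute)

text \<open>Balls are nonempty, so the growth hypothesis keeps \<open>real n powr D\<close> above a
  positive constant, which excludes negative \<open>D\<close>.\<close>

lemma Q_ge_1: "1 \<le> Q"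
proof -
  obtain c1 where c1: "0 < c1" "\<And>n. n \<ge> 1 \<Longrightarrow> c1 \<le> real n powr D"
  proof -
    obtain c1 c2 where c: "c1 > 0" "\<And>n. n \<ge> 1 \<Longrightarrow> c1 * real (card (ball (nat \<lceil>c2 * real n\<rceil>))) \<le> real n powr D"
      using growth by (auto simp: poly_growth_def sim_nat_def volume_eq)
    have "c1 \<le> real n powr D" if "n \<ge> 1" for n
    proof -
      have "1 \<le> real (card (ball (nat \<lceil>c2 * real n\<rceil>)))"
        using card_ball_pos[of "nat \<lceil>c2 * real n\<rceil>"] by linarith
      then have "c1 * 1 \<le> c1 * real (card (ball (nat \<lceil>c2 * real n\<rceil>)))"
        using c(1) by (intro mult_left_mono) auto
      then show ?thesis using c(2)[OF that] by linarith
    qed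
    then show ?thesis using c(1) that by blast
  qed
  have "D \<ge> 0"
  proof (rule ccontr)
    assume "\<not> ?thesis"
    then have "((\<lambda>n::nat. real n powr D) \<longlongrightarrow> 0) sequentially"
      by (intro tendsto_neg_powr filterlim_real_sequentially) auto
    then have "eventually (\<lambda>n::nat. real n powr D < c1) sequentially"
      using c1 by (intro order_tendstoD) auto
    then obtain N where "\<And>n. n \<ge> N \<Longrightarrow> real n powr D < c1"
      by (auto simp: eventually_sequentially)
    from this[of "max 1 N"] c1(2)[of "max 1 N"] show False by simp
  qed
  then show ?thesis by (simp add: Q_def ge_one_powr_ge_zero)
qed

lemma D_nonneg: "0 \<le> D"
proof (rule ccontr)
  assume "\<not> ?thesis"
  then have "Q < 1" by (simp add: Q_def powr_less_one)
  then show False using Q_ge_1 by simp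
qed

text \<open>The growth hypothesis relates \<open>real n powr D\<close> to volumes at rescaled radii.
  To read off the volume at \<open>2 ^ k\<close>, choose \<open>n\<close> so that the rescaled
  radius is at least \<open>2 ^ k\<close> for the upper bound and at most \<open>2 ^ k\<close> for
  the lower one.\<close>

lemma volume_bounds:
  "\<exists>B>0. \<forall>k. real (card (dyad k)) \<le> B * Q ^ k \<and> Q ^ k \<le> B * real (card (dyad k))"
proof -
  obtain c1 c2 c3 c4 where c: "c1 > 0" "c2 > 0" "c3 > 0" "c4 > 0"
    and up: "\<And>n. n \<ge> 1 \<Longrightarrow> c1 * real (card (ball (nat \<lceil>c2 * real n\<rceil>))) \<le> real n powr D"
    and lo: "\<And>n. n \<ge> 1 \<Longrightarrow> real n powr D \<le> c3 * real (card (ball (nat \<lfloor>c4 * real n\<rfloor>)))"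
    using growth by (auto simp: poly_growth_def sim_nat_def volume_eq)
  define B1 where "B1 = (1 / c2 + 1) powr D / c1"
  define B2 where "B2 = c4 powr D + (2 * c4) powr D * c3"
  have "0 < 1 / c2 + 1" using c by (simp add: add_pos_pos)
  then have B: "0 < B1" "0 < B2" using c by (auto simp: B1_def B2_def intro!: add_pos_pos)
  have 1: "real (card (dyad k)) \<le> B1 * Q ^ k" for k
  proof -
    define n where "n = nat \<lceil>2 ^ k / c2\<rceil>"
    have n: "2 ^ k / c2 \<le> real n" "real n \<le> 2 ^ k / c2 + 1" "n \<ge> 1"
      using c by (auto simp: n_def Suc_le_eq)
    have "(2::real) ^ k \<le> c2 * real n" using n(1) c by (simp add: field_simps)
    then have "real (2 ^ k) \<le> real (nat \<lceil>c2 * real n\<rceil>)"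
      unfolding of_nat_power of_nat_numeral using real_nat_ceiling_ge[of "c2 * real n"] by linarith
    then have "2 ^ k \<le> nat \<lceil>c2 * real n\<rceil>" by (simp only: of_nat_le_iff)
    then have "c1 * real (card (dyad k)) \<le> c1 * real (card (ball (nat \<lceil>c2 * real n\<rceil>)))"
      using c unfolding dyad_def by (intro mult_left_mono) (auto intro: card_ball_mono)
    also have "\<dots> \<le> real n powr D" using up n by simp
    also have "\<dots> \<le> ((1 / c2 + 1) * 2 ^ k) powr D"
    proof (intro powr_mono2 D_nonneg)
      have "(1 / c2 + 1) * 2 ^ k = 2 ^ k / c2 + 2 ^ k" by (simp add: algebra_simps)
      then show "real n \<le> (1 / c2 + 1) * 2 ^ k"
        using n(2) one_le_power[of "2::real" k] by linarith
    qed simp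
    also have "\<dots> = (1 / c2 + 1) powr D * Q ^ k"
      using c by (simp add: powr_mult Q_power)
    finally show ?thesis using c by (simp add: B1_def field_simps)
  qed
  have 2: "Q ^ k \<le> B2 * real (card (dyad k))" for k
  proof -
    define n where "n = nat \<lfloor>2 ^ k / c4\<rfloor>"
    have nn: "0 \<le> \<lfloor>2 ^ k / c4\<rfloor>" using c by simp
    have n: "real n \<le> 2 ^ k / c4" "2 ^ k / c4 < real n + 1"
      using nn by (auto simp: n_def)
    have V: "1 \<le> real (card (dyad k))" using card_ball_pos[of "2 ^ k"] unfolding dyad_def by linarith
    show ?thesis
    proof (cases "n = 0")
      \<comment> \<open>The hypothesis says nothing at 0, but then \<open>2 ^ k \<le> c4\<close> and
        \<open>Q ^ k\<close> is bounded by a constant.\<close>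
      case True
      then have "2 ^ k \<le> c4" using n c by (simp add: field_simps)
      then have "Q ^ k \<le> c4 powr D * 1"
        unfolding Q_power using D_nonneg by (simp add: powr_mono2)
      also have "\<dots> \<le> c4 powr D * real (card (dyad k))" using V by (intro mult_left_mono) auto
      also have "\<dots> \<le> B2 * real (card (dyad k))"
        unfolding B2_def using c by (intro mult_right_mono) auto
      finally show ?thesis .
    next
      case False
      have "2 ^ k \<le> c4 * (real n + 1)" using n c by (simp add: field_simps)
      also have "\<dots> \<le> c4 * (2 * real n)" using False c by (intro mult_left_mono) auto
      finally have "Q ^ k \<le> (2 * c4 * real n) powr D"
        unfolding Q_power using D_nonneg by (intro powr_mono2) (auto simp: mult_ac)
      also have "\<dots> = (2 * c4) powr D * real n powr D"
        using c by (simp add: powr_mult)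
      also have "\<dots> \<le> (2 * c4) powr D * (c3 * real (card (ball (nat \<lfloor>c4 * real n\<rfloor>))))"
        using lo[of n] False by (intro mult_left_mono) auto
      also have "\<dots> \<le> (2 * c4) powr D * (c3 * real (card (dyad k)))"
      proof -
        have "c4 * real n \<le> 2 ^ k" using n c by (simp add: field_simps)
        then have "nat \<lfloor>c4 * real n\<rfloor> \<le> 2 ^ k"
          by (metis floor_mono floor_of_int nat_le_iff of_int_numeral of_int_power of_nat_numeral of_nat_power)
        then show ?thesis
          unfolding dyad_def using c by (intro mult_left_mono) (auto intro: card_ball_mono)
      qed
      also have "\<dots> \<le> B2 * real (card (dyad k))"
        unfolding B2_def using c by (simp add: distrib_right)
      finally show ?thesis .
    qed
  qed
  have "real (card (dyad k)) \<le> max B1 B2 * Q ^ k \<and> Q ^ k \<le> max B1 B2 * real (card (dyad k))" for k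
    using order_trans[OF 1[of k] mult_right_mono[of B1 "max B1 B2" "Q ^ k"]] Q_pos
      order_trans[OF 2[of k] mult_right_mono[of B2 "max B1 B2" "real (card (dyad k))"]]
    by simp
  then show ?thesis using B by (intro exI[of _ "max B1 B2"]) auto
qed

lemma tent_square_sum_ge: "4 ^ k * real (card (dyad k)) \<le> (\<Sum>x\<in>dyad (Suc k). (tent (2 ^ Suc k) x)\<^sup>2)"
proof -
  have "4 ^ k * real (card (dyad k)) = (\<Sum>x\<in>dyad k. (2 ^ k)\<^sup>2)"
    by (simp add: power_mult[symmetric] mult.commute[of k]) (simp add: power_mult)
  also have "\<dots> \<le> (\<Sum>x\<in>dyad k. (tent (2 ^ Suc k) x)\<^sup>2)"
  proof (intro sum_mono power_mono)
    fix x assume "x \<in> dyad k"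
    then have "2 ^ k \<le> 2 ^ Suc k - len x" by (auto simp: dyad_def ball_def)
    then have "real (2 ^ k) \<le> real (2 ^ Suc k - len x)" by (rule of_nat_mono)
    then show "2 ^ k \<le> tent (2 ^ Suc k) x" by (simp add: tent_def)
  qed simp
  also have "\<dots> \<le> (\<Sum>x\<in>dyad (Suc k). (tent (2 ^ Suc k) x)\<^sup>2)"
  proof (rule sum_mono2)
    have "(2::nat) ^ k \<le> 2 ^ Suc k" by simp
    then show "dyad k \<subseteq> dyad (Suc k)" unfolding dyad_def ball_def by (auto intro: order_trans)
  qed (auto simp: dyad_def finite_ball)
  finally show ?thesis .
qed

section \<open>Lower bound on return probabilities by test functions\<close>

definition tails_le :: "'a pmf \<Rightarrow> real \<Rightarrow> bool" where
  "tails_le \<psi> M \<longleftrightarrow> (\<forall>k. measure_pmf.prob \<psi> {g \<in> carrier G. 2 ^ k \<le> len g} \<le> M * tail k)"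

text \<open>The Rayleigh quotient of the tent on \<open>dyad k\<close>. The condition
  \<open>1 \<le> k\<close> provides the ball of half the radius, on which the tent is large, and
  \<open>C * tail k \<le> 1\<close> allows the bound to be raised to a power. The constant serves
  all \<open>\<psi>\<close> with the same \<open>M\<close>.\<close>

lemma return_prob_lower:
  assumes M: "0 < M"
  shows "\<exists>C>0. \<forall>\<psi> n k. prob_on G \<psi> \<longrightarrow> symmetric_on G \<psi> \<longrightarrow> tails_le \<psi> M \<longrightarrow> 1 \<le> k \<longrightarrow> C * tail k \<le> 1 \<longrightarrow>
    (1 - C * tail k) ^ (2 * n) \<le> pmf (conv_power G \<psi> (2 * n)) \<one> * card (dyad k)"
proof -
  obtain B where B: "B > 0" "\<And>k. real (card (dyad k)) \<le> B * Q ^ k" "\<And>k. Q ^ k \<le> B * real (card (dyad k))"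
    using volume_bounds by auto
  obtain A where A: "A \<ge> 1" "\<And>i k. i \<le> k \<Longrightarrow> tail i \<le> A * 2 ^ (k - i) * tail k"
    using tail_geometric by auto
  \<comment> \<open>32 is the 4 of the truncated second moment times the 8 of the geometric sum
    below; \<open>B\<close> squared times \<open>Q\<close> compares the balls at scales
    \<open>k\<close> and \<open>k - 1\<close>; \<open>M * A\<close> comes from the tails.\<close>
  define C where "C = 32 * B\<^sup>2 * Q * M * A"
  have C: "0 < C" using B A M Q_pos by (simp add: C_def)
  have "(1 - C * tail k) ^ (2 * n) \<le> pmf (conv_power G \<psi> (2 * n)) \<one> * card (dyad k)"
    if \<psi>: "prob_on G \<psi>" "symmetric_on G \<psi>" and t: "tails_le \<psi> M" and k: "1 \<le> k" "C * tail k \<le> 1" for \<psi> n k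
  proof -
    obtain j where j: "k = Suc j" using k by (cases k) auto
    define a where "a = qform \<psi> (dyad k) (tent (2 ^ k))"
    have sub: "finite (dyad k)" "dyad k \<subseteq> carrier G" "\<And>x. x \<in> dyad k \<Longrightarrow> 0 \<le> tent (2 ^ k) x"
      using finite_ball ball_subset by (auto simp: dyad_def tent_def)
    have a0: "a 0 = (\<Sum>x\<in>dyad k. (tent (2 ^ k) x)\<^sup>2)"
      unfolding a_def by (rule qform_0[OF \<psi> sub])
    have a0_ge: "4 ^ j * real (card (dyad j)) \<le> a 0"
      unfolding a0 j by (rule tent_square_sum_ge)
    have a0_pos: "0 < a 0"
      by (rule less_le_trans[OF _ a0_ge]) (simp add: dyad_def card_ball_pos)
    \<comment> \<open>Up to the factor \<open>A\<close>, each scale down at most doubles the tail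
      while the weight \<open>4 ^ i\<close> shrinks by 4, so the top term dominates.\<close>
    have "(\<Sum>i\<le>k. 4 ^ i * measure_pmf.prob \<psi> {g \<in> carrier G. 2 ^ i \<le> len g})
        \<le> (\<Sum>i\<le>k. M * A * 2 ^ k * tail k * 2 ^ i)"
    proof (rule sum_mono)
      fix i assume i: "i \<in> {..k}"
      have "4 ^ i * measure_pmf.prob \<psi> {g \<in> carrier G. 2 ^ i \<le> len g} \<le> 4 ^ i * (M * tail i)"
        using t by (intro mult_left_mono) (auto simp: tails_le_def)
      also have "\<dots> \<le> 4 ^ i * (M * (A * 2 ^ (k - i) * tail k))"
        using A(2)[of i k] i M by (intro mult_left_mono) auto
      also have "\<dots> = M * A * 2 ^ k * tail k * 2 ^ i"
      proof -
        have "(4::real) ^ i * 2 ^ (k - i) = 2 ^ k * 2 ^ i"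
        proof -
          have "(4::real) ^ i = 2 ^ i * 2 ^ i" by (simp flip: power_mult_distrib)
          moreover have "(2::real) ^ i * 2 ^ (k - i) = 2 ^ k" using i by (simp flip: power_add)
          ultimately show ?thesis by simp
        qed
        then show ?thesis by (simp add: mult_ac)
      qed
      finally show "4 ^ i * measure_pmf.prob \<psi> {g \<in> carrier G. 2 ^ i \<le> len g} \<le> M * A * 2 ^ k * tail k * 2 ^ i" .
    qed
    also have "\<dots> = M * A * 2 ^ k * tail k * (\<Sum>i\<le>k. 2 ^ i)"
      by (rule sum_distrib_left[symmetric])
    also have "\<dots> \<le> M * A * 2 ^ k * tail k * (2 * 2 ^ k)"
    proof (intro mult_left_mono)
      have "(\<Sum>i\<le>k. (2::real) ^ i) = 2 ^ Suc k - 1" by (induction k) auto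
      then show "(\<Sum>i\<le>k. (2::real) ^ i) \<le> 2 * 2 ^ k" by simp
    qed (use M A tail_pos[of k] in auto)
    also have "\<dots> = 8 * M * A * tail k * 4 ^ j"
    proof -
      have "(2::real) ^ k * 2 ^ k = 4 * 4 ^ j" by (simp add: j flip: power_mult_distrib)
      then show ?thesis by (simp add: mult_ac)
    qed
    finally have E: "measure_pmf.expectation \<psi> (\<lambda>y. (real (min (len y) (2 ^ k)))\<^sup>2) \<le> 32 * M * A * tail k * 4 ^ j"
      using expectation_min_square_le[OF \<psi>(1), of k] by simp
    have card: "real (card (dyad k)) \<le> B\<^sup>2 * Q * real (card (dyad j))"
    proof -
      have "real (card (dyad k)) \<le> B * (Q * Q ^ j)" using B(2)[of k] by (simp add: j)
      also have "\<dots> \<le> B * (Q * (B * real (card (dyad j))))"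
        using B Q_pos by (intro mult_left_mono) auto
      finally show ?thesis by (simp add: power2_eq_square mult_ac)
    qed
    have "real (card (dyad k)) * measure_pmf.expectation \<psi> (\<lambda>y. (real (min (len y) (2 ^ k)))\<^sup>2)
        \<le> (B\<^sup>2 * Q * real (card (dyad j))) * (32 * M * A * tail k * 4 ^ j)"
      using B Q_pos by (intro mult_mono card E) auto
    also have "\<dots> = C * tail k * (4 ^ j * real (card (dyad j)))"
      by (simp add: C_def mult_ac)
    also have "\<dots> \<le> C * tail k * a 0"
      using C tail_pos[of k] by (intro mult_left_mono a0_ge) auto
    finally have "(1 - C * tail k) * a 0 \<le> a 1"
      using qform_tent_ge[OF \<psi>, of "2 ^ k"] by (simp add: a_def dyad_def left_diff_distrib)
    then have "1 - C * tail k \<le> a 1 / a 0" using a0_pos by (simp add: field_simps)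
    then have "(1 - C * tail k) ^ (2 * n) \<le> (a 1 / a 0) ^ (2 * n)"
      using k by (intro power_mono) auto
    also have "\<dots> \<le> pmf (conv_power G \<psi> (2 * n)) \<one> * card (dyad k)"
      using return_prob_ge[where f = "tent (2 ^ k)", OF \<psi> sub] a0_pos unfolding a_def by blast
    finally show ?thesis .
  qed
  then show ?thesis using C by blast
qed

section \<open>Upper bound on return probabilities by decomposition into balls\<close>

definition jump_ge :: "'a pmf \<Rightarrow> real \<Rightarrow> bool" where
  "jump_ge \<mu> a \<longleftrightarrow> (\<forall>g\<in>carrier G.
     a / ((1 + real (len g)) powr D * l (1 + (real (len g))\<^sup>2)) \<le> pmf \<mu> g)"

text \<open>If \<open>i\<close> is the first scale whose ball contains \<open>g\<close>, only the
  balls with \<open>j \<ge> i\<close> count. As \<open>0 < D\<close>, their heights decay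
  geometrically with ratio at most \<open>1 / Q\<close>, so the first one dominates; it is compared
  with the density at \<open>g\<close>.\<close>

lemma jump_dyadic_ge:
  assumes a: "0 < a" and \<mu>: "jump_ge \<mu> a" and D: "0 < D"
  shows "\<exists>\<epsilon>>0. \<forall>K. \<forall>g\<in>carrier G. (\<Sum>j<K. \<epsilon> * lam j / Q ^ j * indicator (dyad j) g) \<le> pmf \<mu> g"
proof -
  obtain A where A: "0 < A" "\<And>j. lam j \<le> A * lam (Suc j)" using lam_doubling by auto
  define q where "q = 1 / Q"
  have "1 < Q" using D by (simp add: Q_def)
  then have q: "0 < q" "q < 1" by (auto simp: q_def)
  \<comment> \<open>\<open>1 - q\<close> cancels the geometric series, \<open>q\<close> pays for the
    radius \<open>2 * 2 ^ i\<close> instead of \<open>2 ^ i\<close>, and \<open>A\<close> for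
    passing from \<open>lam i\<close> to \<open>lam (Suc i)\<close>.\<close>
  define \<epsilon> where "\<epsilon> = a * q * (1 - q) / A"
  have \<epsilon>: "0 < \<epsilon>" using a q A by (simp add: \<epsilon>_def)
  have "(\<Sum>j<K. \<epsilon> * lam j / Q ^ j * indicator (dyad j) g) \<le> pmf \<mu> g" if g: "g \<in> carrier G" for K g
  proof -
    define i where "i = (LEAST i. len g \<le> 2 ^ i)"
    have ex: "len g \<le> 2 ^ len g" using less_exp[of "len g"] by simp
    have i: "len g \<le> 2 ^ i" unfolding i_def using ex by (rule LeastI)
    have i_le: "i \<le> j" if "g \<in> dyad j" for j
      unfolding i_def using that by (intro Least_le) (simp add: dyad_def ball_def)
    have summand: "\<epsilon> * lam j / Q ^ j * indicator (dyad j) g \<le> (if i \<le> j then \<epsilon> * lam i * q ^ j else 0)" for j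
    proof (cases "g \<in> dyad j")
      case True
      have "lam j \<le> lam i" using decseqD[OF decseq_lam i_le[OF True]] .
      then have "\<epsilon> * lam j * q ^ j \<le> \<epsilon> * lam i * q ^ j"
        using \<epsilon> q by (intro mult_right_mono mult_left_mono) auto
      then show ?thesis using True i_le[OF True] by (simp add: q_def power_one_over field_simps)
    next
      case False
      then show ?thesis using \<epsilon> q lam_nonneg by simp
    qed
    have "(\<Sum>j<K. \<epsilon> * lam j / Q ^ j * indicator (dyad j) g) \<le> (\<Sum>j<K. if i \<le> j then \<epsilon> * lam i * q ^ j else 0)"
      by (intro sum_mono summand)
    also have "\<dots> = (\<Sum>j\<in>{i..<K}. \<epsilon> * lam i * q ^ j)"
      by (rule sum.mono_neutral_cong_right) auto
    also have "\<dots> \<le> \<epsilon> * lam i * (q ^ i / (1 - q))"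
      unfolding sum_distrib_left[symmetric] using \<epsilon> q lam_nonneg[of i]
      by (intro mult_left_mono sum_geometric_le) auto
    also have "\<dots> = a * q * q ^ i * (lam i / A)"
    proof -
      have "a * q * u / A * lam i * (q ^ i / u) = a * q * q ^ i * (lam i / A)" if "u \<noteq> 0" for u
        using that by simp
      from this[of "1 - q"] show ?thesis using q by (simp add: \<epsilon>_def)
    qed
    also have "\<dots> \<le> a * q * q ^ i * lam (Suc i)"
      using A a q by (intro mult_left_mono) (auto simp: field_simps)
    also have "\<dots> = a / ((2 * 2 ^ i) powr D * l (4 ^ Suc i))"
      by (simp add: lam_def q_def Q_power powr_mult Q_def power_one_over)
         (simp add: Q_power[unfolded Q_def] powr_mult)
    also have "\<dots> \<le> a / ((1 + real (len g)) powr D * l (1 + (real (len g))\<^sup>2))"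
    proof (intro divide_left_mono mult_mono powr_mono2 l_le mult_pos_pos)
      have leni: "real (len g) \<le> 2 ^ i" using i by (metis of_nat_le_iff of_nat_numeral of_nat_power)
      then show "1 + real (len g) \<le> 2 * 2 ^ i"
        using one_le_power[of "2::real" i] by linarith
      have "(real (len g))\<^sup>2 \<le> (2 ^ i)\<^sup>2" using leni by (intro power_mono) auto
      also have "\<dots> = (4::real) ^ i" by (simp add: power_mult[symmetric] mult.commute[of i]) (simp add: power_mult)
      finally show "1 + (real (len g))\<^sup>2 \<le> 4 ^ Suc i"
        unfolding power_Suc using one_le_power[of "4::real" i] by linarith
    qed (use a D in \<open>auto intro!: l_pos l_nonneg add_pos_nonneg\<close>)
    also have "\<dots> \<le> pmf \<mu> g" using \<mu> g by (simp add: jump_ge_def)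
    finally show ?thesis .
  qed
  then show ?thesis using \<epsilon> by blast
qed

text \<open>Apply \<open>return_prob_le_sum\<close> to the dyadic balls below a cutoff
  \<open>K\<close>. The condition on \<open>K\<close> ensures that leaving out the scales from
  \<open>K\<close> on costs at most the factor \<open>exp c\<close>.\<close>

lemma return_prob_upper:
  assumes \<mu>: "prob_on G \<mu>" "jump_ge \<mu> a" and a: "0 < a" and D: "0 < D"
  shows "\<exists>c>0. \<exists>C>0. \<forall>n K. real n * tail K \<le> 1 \<longrightarrow>
    pmf (conv_power G \<mu> n) \<one> \<le> C * (\<Sum>k\<le>K. exp (- c * real n * tail k) * (1 / Q) ^ k)"
proof -
  obtain B where B: "B > 0" "\<And>k. real (card (dyad k)) \<le> B * Q ^ k" "\<And>k. Q ^ k \<le> B * real (card (dyad k))"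
    using volume_bounds by auto
  obtain \<epsilon> where \<epsilon>: "0 < \<epsilon>"
    "\<And>K g. g \<in> carrier G \<Longrightarrow> (\<Sum>j<K. \<epsilon> * lam j / Q ^ j * indicator (dyad j) g) \<le> pmf \<mu> g"
    using jump_dyadic_ge[OF a \<mu>(2) D] by auto
  define c where "c = \<epsilon> / B"
  define C where "C = exp c * (1 + B * Q)"
  have c: "0 < c" "0 < C" using \<epsilon> B Q_pos by (auto simp: c_def C_def add_pos_pos)
  have "pmf (conv_power G \<mu> n) \<one> \<le> C * (\<Sum>k\<le>K. exp (- c * real n * tail k) * (1 / Q) ^ k)"
    if nK: "real n * tail K \<le> 1" for n K
  proof -
    define m where "m k = 1 - (\<Sum>j\<in>{k..<K}. \<epsilon> * lam j / Q ^ j * real (card (dyad j)))" for k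
    define e where "e k = exp (- c * real n * tail k)" for k
    have pre: "0 \<le> \<epsilon> * lam j / Q ^ j" "finite (dyad j)" "dyad j \<subseteq> carrier G" "dyad j \<noteq> {}" for j
      using \<epsilon> lam_nonneg Q_pos finite_ball ball_subset unfolding dyad_def
      by (auto intro: exI[of _ \<one>] one_in_ball simp: ex_in_conv[symmetric] simp del: ex_in_conv)
    have main: "pmf (conv_power G \<mu> n) \<one> \<le> m 0 ^ n + (\<Sum>k<K. (m (Suc k) ^ n - m k ^ n) / card (dyad k))"
      and m0: "0 \<le> m 0"
      unfolding m_def
      by (rule return_prob_le_sum(1)[OF \<mu>(1) pre \<epsilon>(2)], assumption)
         (rule return_prob_le_sum(2)[OF \<mu>(1) pre \<epsilon>(2)])
    have m_nonneg: "0 \<le> m k" for k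
    proof -
      have "(\<Sum>j\<in>{k..<K}. \<epsilon> * lam j / Q ^ j * real (card (dyad j)))
          \<le> (\<Sum>j\<in>{0..<K}. \<epsilon> * lam j / Q ^ j * real (card (dyad j)))"
        by (intro sum_mono2 mult_nonneg_nonneg pre(1)) auto
      then show ?thesis using m0 by (simp add: m_def)
    qed
    \<comment> \<open>The mass removed from scale \<open>k\<close> on is at least
      \<open>c * (tail k - tail K)\<close>; conclude with \<open>1 + x \<le> exp x\<close>.\<close>
    have m_pow: "m k ^ n \<le> exp c * e k" if "k \<le> K" for k
    proof -
      have "c * lam j \<le> \<epsilon> * lam j / Q ^ j * real (card (dyad j))" for j
      proof -
        have "1 / B \<le> real (card (dyad j)) / Q ^ j"
          using B(1) B(3)[of j] Q_pos by (simp add: field_simps)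
        then have "\<epsilon> * lam j * (1 / B) \<le> \<epsilon> * lam j * (real (card (dyad j)) / Q ^ j)"
          using \<epsilon> lam_nonneg by (intro mult_left_mono) auto
        then show ?thesis by (simp add: c_def)
      qed
      then have "(\<Sum>j\<in>{k..<K}. c * lam j) \<le> 1 - m k"
        unfolding m_def by (auto intro: sum_mono)
      then have "m k \<le> 1 + (- (c * (tail k - tail K)))"
        using sum_lam[OF that] by (simp add: sum_distrib_left[symmetric])
      also have "\<dots> \<le> exp (- (c * (tail k - tail K)))" by (rule exp_ge_add_one_self)
      finally have "m k ^ n \<le> exp (- (c * (tail k - tail K))) ^ n"
        using m_nonneg by (intro power_mono)
      also have "\<dots> = exp (c * (real n * tail K)) * e k"
        unfolding e_def by (simp flip: exp_of_nat_mult exp_add) (simp add: algebra_simps)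
      also have "\<dots> \<le> exp c * e k"
        using mult_left_mono[OF nK, of c] c by (intro mult_right_mono) (auto simp: e_def)
      finally show ?thesis .
    qed
    \<comment> \<open>Dropping the subtracted power leaves an exponent at \<open>Suc k\<close>,
      whereas the volume belongs to scale \<open>k\<close>; the mismatch costs one factor
      \<open>Q\<close>.\<close>
    have summand: "(m (Suc k) ^ n - m k ^ n) / card (dyad k) \<le> exp c * (B * Q) * (e (Suc k) * (1 / Q) ^ Suc k)"
      if "k < K" for k
    proof -
      have pos: "0 < real (card (dyad k))" by (simp add: dyad_def card_ball_pos)
      have "(m (Suc k) ^ n - m k ^ n) / card (dyad k) \<le> exp c * e (Suc k) / card (dyad k)"
        using m_pow[of "Suc k"] that m_nonneg[of k] zero_le_power[of "m k" n] pos
        by (intro divide_right_mono) linarith+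
      also have "\<dots> \<le> exp c * e (Suc k) * (B / Q ^ k)"
      proof -
        have "1 / real (card (dyad k)) \<le> B / Q ^ k" using B(3)[of k] pos Q_pos by (simp add: field_simps)
        from mult_left_mono[OF this, of "exp c * e (Suc k)"] show ?thesis by (simp add: e_def)
      qed
      also have "\<dots> = exp c * (B * Q) * (e (Suc k) * (1 / Q) ^ Suc k)"
        using Q_pos by (simp add: power_one_over)
      finally show ?thesis .
    qed
    have "pmf (conv_power G \<mu> n) \<one> \<le> exp c * e 0 + (\<Sum>k<K. exp c * (B * Q) * (e (Suc k) * (1 / Q) ^ Suc k))"
      using m_pow[of 0] by (intro order_trans[OF main] add_mono sum_mono summand) auto
    also have "\<dots> = exp c * e 0 + exp c * (B * Q) * (\<Sum>k<K. e (Suc k) * (1 / Q) ^ Suc k)"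
      by (simp only: sum_distrib_left)
    also have "\<dots> \<le> C * e 0 + C * (\<Sum>k<K. e (Suc k) * (1 / Q) ^ Suc k)"
      using B Q_pos unfolding C_def e_def
      by (intro add_mono mult_right_mono sum_nonneg) (auto simp: algebra_simps)
    also have "\<dots> = C * (\<Sum>k\<le>K. e k * (1 / Q) ^ k)"
      unfolding lessThan_Suc_atMost[symmetric] sum.lessThan_Suc_shift by (simp add: distrib_left)
    finally show ?thesis by (simp add: e_def)
  qed
  then show ?thesis using c by blast
qed

section \<open>Comparison of two walks\<close>

text \<open>The lower bound for \<open>\<psi>\<close> holds scale by scale, the upper bound for
  \<open>\<mu>\<close> is a sum over scales; \<open>sum_exp_power_le_sup\<close> bounds that sum by
  the supremum. The constants see \<open>\<psi>\<close> only through \<open>M\<close>, which permits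
  taking an infimum over \<open>\<psi>\<close> later.\<close>

lemma return_prob_compare:
  assumes \<mu>: "prob_on G \<mu>" "jump_ge \<mu> a" and a: "0 < a" and M: "0 < M"
  shows "\<exists>c>0. \<exists>C>0. \<forall>\<psi> n. prob_on G \<psi> \<longrightarrow> symmetric_on G \<psi> \<longrightarrow> tails_le \<psi> M \<longrightarrow>
    pmf (conv_power G \<mu> n) \<one> \<le> C * pmf (conv_power G \<psi> (2 * nat \<lfloor>c * real n\<rfloor>)) \<one>"
proof -
  obtain B where B: "B > 0" "\<And>k. real (card (dyad k)) \<le> B * Q ^ k"
    using volume_bounds by auto
  obtain C0 where C0: "0 < C0" "\<And>\<psi> n k. prob_on G \<psi> \<Longrightarrow> symmetric_on G \<psi> \<Longrightarrow> tails_le \<psi> M \<Longrightarrow>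
    1 \<le> k \<Longrightarrow> C0 * tail k \<le> 1 \<Longrightarrow>
    (1 - C0 * tail k) ^ (2 * n) \<le> pmf (conv_power G \<psi> (2 * n)) \<one> * card (dyad k)"
    using return_prob_lower[OF M] by blast
  obtain b A where b: "0 < b" and A: "0 < A" and up: "\<And>n K. 0 < D \<Longrightarrow> real n * tail K \<le> 1 \<Longrightarrow>
    pmf (conv_power G \<mu> n) \<one> \<le> A * (\<Sum>k\<le>K. exp (- b * real n * tail k) * (1 / Q) ^ k)"
  proof (cases "0 < D")
    case True
    then show ?thesis using return_prob_upper[OF \<mu> a True] that by blast
  next
    \<comment> \<open>The premise \<open>0 < D\<close> makes the claim vacuous here, and any
      positive constants do.\<close>
    case False
    then show ?thesis using that[of 1 1] by simp
  qed
  have "eventually (\<lambda>k. tail k < 1 / (2 * C0)) sequentially"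
    using C0(1) by (intro order_tendstoD(2)[OF tail_tendsto]) auto
  then obtain k0 where "\<And>k. k \<ge> k0 \<Longrightarrow> tail k < 1 / (2 * C0)"
    by (auto simp: eventually_sequentially)
  \<comment> \<open>From scale \<open>k1\<close> on, \<open>y = C0 * tail k\<close> is at most one
    half, where \<open>exp (- (2 * y)) \<le> 1 - y\<close>; the earlier scales cost the constant
    \<open>Q ^ k1\<close>.\<close>
  then obtain k1 where k1: "1 \<le> k1" "\<And>k. k \<ge> k1 \<Longrightarrow> C0 * tail k \<le> 1 / 2"
    using C0(1) by (intro that[of "max 1 k0"]) (auto simp: field_simps less_imp_le)
  \<comment> \<open>With \<open>2 * N \<le> 2 * c * n\<close> steps the exponent is at most
    \<open>4 * C0 * c * n * tail k = b / 2 * n * tail k\<close>. This is half the rate of the upper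
    bound, as \<open>sum_exp_power_le_sup\<close> demands.\<close>
  define c where "c = b / (8 * C0)"
  have c: "0 < c" using b C0 by (simp add: c_def)
  define U where "U \<psi> n = Q ^ k1 * (B * pmf (conv_power G \<psi> (2 * nat \<lfloor>c * real n\<rfloor>)) \<one>)" for \<psi> n
  have lower: "exp (- (b / 2 * real n) * tail k) * (1 / Q) ^ k \<le> U \<psi> n"
    if \<psi>: "prob_on G \<psi>" "symmetric_on G \<psi>" "tails_le \<psi> M" for \<psi> n k
  proof -
    define N where "N = nat \<lfloor>c * real n\<rfloor>"
    have N: "real N \<le> c * real n" using c by (simp add: N_def)
    have large: "exp (- (b / 2 * real n) * tail k) * (1 / Q) ^ k \<le> B * pmf (conv_power G \<psi> (2 * N)) \<one>"
      if "k1 \<le> k" for k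
    proof -
      define y where "y = C0 * tail k"
      have y: "0 \<le> y" "y \<le> 1 / 2" using k1(2)[OF that] C0 tail_pos[of k] by (auto simp: y_def)
      have "exp (- (2 * y)) \<le> 1 - y"
      proof -
        have "1 \<le> (1 - y) * (1 + 2 * y)" using y mult_left_mono[of y "1/2" y] by (simp add: algebra_simps)
        also have "\<dots> \<le> (1 - y) * exp (2 * y)"
          using y by (intro mult_left_mono exp_ge_add_one_self) auto
        finally show ?thesis by (simp add: exp_minus field_simps)
      qed
      have "b / 2 * real n * tail k \<ge> real (2 * N) * (2 * y)"
      proof -
        have "real (2 * N) * (2 * y) = 4 * y * real N" by simp
        also have "\<dots> \<le> 4 * y * (c * real n)" using y N by (intro mult_left_mono) auto
        also have "\<dots> = b / 2 * real n * tail k" using C0 by (simp add: y_def c_def)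
        finally show ?thesis .
      qed
      then have "exp (- (b / 2 * real n) * tail k) \<le> exp (real (2 * N) * (- (2 * y)))"
        by simp
      also have "\<dots> = exp (- (2 * y)) ^ (2 * N)" by (rule exp_of_nat_mult)
      also have "\<dots> \<le> (1 - y) ^ (2 * N)" using \<open>exp (- (2 * y)) \<le> 1 - y\<close> by (intro power_mono) auto
      also have "\<dots> \<le> pmf (conv_power G \<psi> (2 * N)) \<one> * card (dyad k)"
        using C0(2)[OF \<psi>, of k N] that k1(1) y unfolding y_def by simp
      also have "\<dots> \<le> pmf (conv_power G \<psi> (2 * N)) \<one> * (B * Q ^ k)"
        using B by (intro mult_left_mono) auto
      finally have "exp (- (b / 2 * real n) * tail k) * (1 / Q) ^ k
          \<le> pmf (conv_power G \<psi> (2 * N)) \<one> * (B * Q ^ k) * (1 / Q) ^ k"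
        using Q_pos by (intro mult_right_mono) auto
      then show ?thesis using Q_pos by (simp add: power_one_over mult.commute)
    qed
    show ?thesis
    proof (cases "k1 \<le> k")
      case True
      have "1 * (B * pmf (conv_power G \<psi> (2 * N)) \<one>) \<le> U \<psi> n"
        unfolding U_def N_def using Q_ge_1 B by (intro mult_right_mono one_le_power) auto
      then show ?thesis using large[OF True] by simp
    next
      case False
      have "exp (- (b / 2 * real n) * tail k) \<le> exp (- (b / 2 * real n) * tail k1)"
        using tail_mono[of k k1] False b by (simp add: mult_left_mono)
      moreover have "(1 / Q) ^ k \<le> 1" using Q_ge_1 by (intro power_le_one) auto
      ultimately have "exp (- (b / 2 * real n) * tail k) * (1 / Q) ^ k \<le> exp (- (b / 2 * real n) * tail k1) * 1"
        using Q_pos by (intro mult_mono) auto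
      also have "\<dots> = Q ^ k1 * (exp (- (b / 2 * real n) * tail k1) * (1 / Q) ^ k1)"
        using Q_pos by (simp add: power_one_over)
      also have "\<dots> \<le> U \<psi> n"
        unfolding U_def N_def[symmetric] using Q_pos by (intro mult_left_mono large) auto
      finally show ?thesis .
    qed
  qed
  define C where "C = (if 0 < D then A * (2 / (1 - (1 / Q) powr (1 / 4))) else 1) * (Q ^ k1 * B)"
  have fac: "0 < 2 / (1 - (1 / Q) powr (1 / 4))" if "0 < D"
  proof -
    have "1 < Q" using that by (simp add: Q_def)
    then have "(1 / Q) powr (1 / 4) < 1" using powr_less_mono2[of "1 / 4" "1 / Q" 1] by simp
    then show ?thesis by simp
  qed
  have C: "0 < C" using A B Q_pos fac by (simp add: C_def)
  have "pmf (conv_power G \<mu> n) \<one> \<le> C * pmf (conv_power G \<psi> (2 * nat \<lfloor>c * real n\<rfloor>)) \<one>"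
    if \<psi>: "prob_on G \<psi>" "symmetric_on G \<psi>" "tails_le \<psi> M" for \<psi> n
  proof (cases "0 < D")
    case True
    have Q1: "1 < Q" using True by (simp add: Q_def)
    have "(\<lambda>K. real n * tail K) \<longlonglongrightarrow> real n * 0" by (intro tendsto_intros tail_tendsto)
    then have "eventually (\<lambda>K. real n * tail K < 1) sequentially"
      using order_tendstoD(2)[of "\<lambda>K. real n * tail K" "real n * 0" sequentially 1] by simp
    then obtain K where K: "real n * tail K \<le> 1"
      by (auto simp: eventually_sequentially intro: less_imp_le)
    have "(\<Sum>k\<le>K. exp (- 2 * (b / 2 * real n) * tail k) * (1 / Q) ^ k)
        \<le> 2 / (1 - (1 / Q) powr (1 / 4)) * U \<psi> n"
      using Q1 b lower[OF \<psi>] decseq_tail decseq_tail_diff tail_tendsto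
      by (intro sum_exp_power_le_sup) auto
    then have "A * (\<Sum>k\<le>K. exp (- b * real n * tail k) * (1 / Q) ^ k)
        \<le> A * (2 / (1 - (1 / Q) powr (1 / 4)) * U \<psi> n)"
      using A by (intro mult_left_mono) auto
    with up[OF True K] show ?thesis using True by (simp add: C_def U_def mult_ac)
  next
    \<comment> \<open>Now \<open>D = 0\<close> and \<open>Q = 1\<close>. Letting \<open>k\<close>
      tend to infinity in the lower bound gives \<open>1 \<le> U \<psi> n\<close>, and a probability
      is at most 1.\<close>
    case False
    then have "Q = 2 powr 0" unfolding Q_def using D_nonneg by simp
    then have Q1: "Q = 1" by simp
    have "(\<lambda>k. exp (- (b / 2 * real n) * tail k)) \<longlonglongrightarrow> exp (- (b / 2 * real n) * 0)"
      by (intro tendsto_intros tail_tendsto)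
    then have "exp (- (b / 2 * real n) * 0) \<le> U \<psi> n"
      using lower[OF \<psi>, of n] by (intro LIMSEQ_le_const2[where a = "U \<psi> n"]) (auto simp: Q1)
    then show ?thesis
      using False pmf_le_1[of "conv_power G \<mu> n" \<one>] by (simp add: C_def U_def mult_ac)
  qed
  then show ?thesis using c C by blast
qed

end

section \<open>Weak moments\<close>

context group
begin

section \<open>Lazy walks\<close>

text \<open>Staying put with probability \<open>1 - p\<close> scales all tails by \<open>p\<close>
  and keeps at least \<open>p\<close> times the mass of every point: a smaller weak moment is bought
  by a slower walk.\<close>

definition lazy :: "real \<Rightarrow> 'a pmf \<Rightarrow> 'a pmf" where
  "lazy p \<mu> = bind_pmf (bernoulli_pmf p) (\<lambda>b. if b then \<mu> else return_pmf \<one>)"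

lemma prob_on_lazy: "prob_on G \<mu> \<Longrightarrow> prob_on G (lazy p \<mu>)"
  by (auto simp: prob_on_def lazy_def split: if_splits)

lemma pmf_lazy:
  "0 \<le> p \<Longrightarrow> p \<le> 1 \<Longrightarrow> pmf (lazy p \<mu>) g = p * pmf \<mu> g + (1 - p) * indicator {\<one>} g"
  by (simp add: lazy_def pmf_bind mult.commute indicator_def)

lemma prob_lazy:
  assumes "0 \<le> p" "p \<le> 1" "\<one> \<notin> X"
  shows "measure_pmf.prob (lazy p \<mu>) X = p * measure_pmf.prob \<mu> X"
proof -
  have "emeasure (measure_pmf (lazy p \<mu>)) X = emeasure (measure_pmf \<mu>) X * ennreal p"
    using assms by (simp add: lazy_def emeasure_bind_pmf)
  then have "ennreal (measure_pmf.prob (lazy p \<mu>) X) = ennreal (p * measure_pmf.prob \<mu> X)"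
    using assms by (simp add: measure_pmf.emeasure_eq_measure ennreal_mult mult.commute)
  then show ?thesis using assms by simp
qed

lemma symmetric_on_lazy:
  assumes "0 \<le> p" "p \<le> 1" "symmetric_on G \<mu>"
  shows "symmetric_on G (lazy p \<mu>)"
  unfolding symmetric_on_def
proof
  fix g assume g: "g \<in> carrier G"
  have "pmf \<mu> g = pmf \<mu> (inv g)" using assms(3) g unfolding symmetric_on_def by blast
  moreover have "inv g = \<one> \<longleftrightarrow> g = \<one>" using g by (metis inv_inv inv_one)
  ultimately show "pmf (lazy p \<mu>) g = pmf (lazy p \<mu>) (inv g)"
    using assms by (simp add: pmf_lazy indicator_def)
qed

end

context growth_setup
begin

section \<open>The weak moment condition and tail bounds\<close>

lemma theta2_mono: "0 < r \<Longrightarrow> r \<le> m \<Longrightarrow> theta2 l (real r) \<le> theta2 l (real m)"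
proof -
  assume rm: "0 < r" "r \<le> m"
  then have 1: "1 \<le> (real r)\<^sup>2" "(real r)\<^sup>2 \<le> (real m)\<^sup>2"
    by (auto intro!: power_mono one_le_power)
  then have "J ((real m)\<^sup>2) \<le> J ((real r)\<^sup>2)" by (rule J_antimono)
  then show ?thesis
    using rm J_pos[OF 1(1)] J_pos[OF order_trans[OF 1]]
    by (simp add: theta2_eq) (intro divide_left_mono, auto)
qed

lemma theta2_dyadic: "theta2 l (real (2 ^ k)) = 1 / (2 * J (4 ^ k))"
proof -
  have "(real (2 ^ k))\<^sup>2 = 4 ^ k"
    by (simp add: power_mult[symmetric] mult.commute[of k]) (simp add: power_mult)
  then show ?thesis by (simp add: theta2_eq)
qed

text \<open>From length \<open>2 ^ k\<close> on, \<open>theta2 l\<close> is at least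
  \<open>t = 1 / (2 * J (4 ^ k))\<close>. The weak moment has a strict inequality, so it is tested
  at \<open>t / 2\<close>; this bounds the tail by \<open>4 / t = 8 * J (4 ^ k)\<close>, and
  \<open>J_bounds\<close> yields 24.\<close>

lemma weak_class_tails_le:
  assumes "\<psi> \<in> weak_class G S (theta2 l)"
  shows "tails_le \<psi> 24"
  unfolding tails_le_def
proof
  fix k
  let ?X = "{g \<in> carrier G. 2 ^ k \<le> len g}"
  define t where "t = 1 / (2 * J (4 ^ k))"
  have J: "0 < J (4 ^ k)" by (rule J_pos) simp
  then have t: "0 < t" by (simp add: t_def)
  have sub: "?X \<subseteq> {g \<in> carrier G. theta2 l (real (len g)) > t / 2}"
  proof
    fix g assume g: "g \<in> ?X"
    then have "t \<le> theta2 l (real (len g))"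
      using theta2_mono[of "2 ^ k" "len g"] theta2_dyadic[of k] by (simp add: t_def)
    then show "g \<in> {g \<in> carrier G. theta2 l (real (len g)) > t / 2}"
      using g t by auto
  qed
  have "ennreal (t / 2) * emeasure (measure_pmf \<psi>) ?X
      \<le> ennreal (t / 2) * emeasure (measure_pmf \<psi>) {g \<in> carrier G. theta2 l (real (len g)) > t / 2}"
    using sub by (intro mult_left_mono emeasure_mono) auto
  also have "\<dots> \<le> weak_moment G S (theta2 l) \<psi>"
    unfolding weak_moment_def using t by (intro SUP_upper) auto
  also have "\<dots> \<le> ennreal 2"
    using assms by (simp add: weak_class_def)
  also have "ennreal (t / 2) * emeasure (measure_pmf \<psi>) ?X = ennreal (t / 2 * measure_pmf.prob \<psi> ?X)"
    unfolding measure_pmf.emeasure_eq_measure using t by (intro ennreal_mult[symmetric]) auto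
  finally have "t / 2 * measure_pmf.prob \<psi> ?X \<le> 2"
    by (subst (asm) ennreal_le_iff) auto
  then have "measure_pmf.prob \<psi> ?X \<le> 8 * J (4 ^ k)"
    using J by (simp add: t_def field_simps)
  then show "measure_pmf.prob \<psi> ?X \<le> 24 * tail k"
    using J_bounds(2)[of k] by simp
qed

text \<open>All elements of a superlevel set of \<open>theta2 l\<close> are at least as long as its
  shortest one, \<open>g\<close>. So the tail at the scale of \<open>g\<close> controls the
  probability, while \<open>s\<close> is at most \<open>theta2 l\<close> one scale further
  out.\<close>

lemma tails_le_weak_class:
  "\<exists>\<delta>>0. \<forall>\<psi>. prob_on G \<psi> \<longrightarrow> symmetric_on G \<psi> \<longrightarrow> tails_le \<psi> \<delta> \<longrightarrow> \<psi> \<in> weak_class G S (theta2 l)"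
proof -
  obtain A where A: "A \<ge> 1" "\<And>i k. i \<le> k \<Longrightarrow> tail i \<le> A * 2 ^ (k - i) * tail k"
    using tail_geometric by auto
  \<comment> \<open>The level involves \<open>tail (k + 2)\<close> and the probability
    \<open>tail k\<close>, at most \<open>4 * A\<close> times larger; with this
    \<open>\<delta>\<close> their product is at most \<open>4 / 3\<close>.\<close>
  define \<delta> where "\<delta> = 1 / (2 * A)"
  have \<delta>: "0 < \<delta>" using A by (simp add: \<delta>_def)
  have "weak_moment G S (theta2 l) \<psi> \<le> 2" if t: "tails_le \<psi> \<delta>" for \<psi>
    unfolding weak_moment_def
  proof (rule SUP_least)
    fix s :: real assume "s \<in> {0<..}"
    then have s: "0 < s" by simp
    let ?X = "{g \<in> carrier G. theta2 l (real (len g)) > s}"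
    show "ennreal s * emeasure (measure_pmf \<psi>) ?X \<le> 2"
    proof (cases "?X = {}")
      case False
      then obtain g where g: "g \<in> ?X" "\<And>h. h \<in> ?X \<Longrightarrow> len g \<le> len h"
        using ex_has_least_nat[of "\<lambda>g. g \<in> ?X" _ len] by blast
      \<comment> \<open>By the convention at 0 the shortest element has positive length, hence a
        dyadic scale.\<close>
      have "theta2 l 0 = 0" by (simp add: theta2_def theta_def)
      then have "len g \<noteq> 0" using g(1) s by (intro notI) simp
      then obtain k where k: "2 ^ k \<le> len g" "len g < 2 ^ (k + 1)"
        using ex_power_ivl1[of 2 "len g"] by auto
      have "s \<le> theta2 l (real (2 ^ Suc k))"
        using g(1) theta2_mono[of "len g" "2 ^ Suc k"] k \<open>len g \<noteq> 0\<close> by simp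
      also have "\<dots> = 1 / (2 * J (4 ^ Suc k))" by (rule theta2_dyadic)
      also have "\<dots> \<le> 1 / (2 * (3 / 4 * tail (Suc (Suc k))))"
        using J_bounds(1)[of "Suc k"] tail_pos[of "Suc (Suc k)"] J_pos[of "4 ^ Suc k"]
        by (intro divide_left_mono mult_left_mono) auto
      finally have s_le: "s \<le> 1 / (2 * (3 / 4 * tail (Suc (Suc k))))" .
      have "measure_pmf.prob \<psi> ?X \<le> measure_pmf.prob \<psi> {g \<in> carrier G. 2 ^ k \<le> len g}"
        using g(2) k(1) by (intro measure_pmf.finite_measure_mono) (auto intro: order_trans)
      also have "\<dots> \<le> \<delta> * tail k" using t by (simp add: tails_le_def)
      also have "\<dots> \<le> \<delta> * (A * 4 * tail (Suc (Suc k)))"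
        using A(2)[of k "Suc (Suc k)"] \<delta> by (intro mult_left_mono) (auto simp: Suc_diff_le)
      also have "\<dots> = 2 * tail (Suc (Suc k))" using A by (simp add: \<delta>_def)
      finally have "s * measure_pmf.prob \<psi> ?X
          \<le> 1 / (2 * (3 / 4 * tail (Suc (Suc k)))) * (2 * tail (Suc (Suc k)))"
        using s_le tail_pos[of "Suc (Suc k)"] by (intro mult_mono) auto
      also have "\<dots> \<le> 2" using tail_pos[of "Suc (Suc k)"] by simp
      finally have "ennreal (s * measure_pmf.prob \<psi> ?X) \<le> ennreal 2" by (rule ennreal_leI)
      then show ?thesis
        using s by (simp add: measure_pmf.emeasure_eq_measure ennreal_mult)
    next
      case True
      then show ?thesis by (simp only: emeasure_empty) simp
    qed
  qed
  then have "\<forall>\<psi>. prob_on G \<psi> \<longrightarrow> symmetric_on G \<psi> \<longrightarrow> tails_le \<psi> \<delta> \<longrightarrow> \<psi> \<in> weak_class G S (theta2 l)"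
    by (auto simp: weak_class_def)
  then show ?thesis using \<delta> by blast
qed

text \<open>The shell at scale \<open>j\<close> has at most \<open>B * Q ^ Suc j\<close> elements,
  each of mass at most \<open>b / Q ^ j * lam j\<close>; the powers of \<open>Q\<close> cancel up to
  a constant, and summing the shells gives \<open>tail k\<close>.\<close>

lemma jump_le_tails_le:
  assumes b: "0 < b"
    and le: "\<And>g. g \<in> carrier G \<Longrightarrow> pmf \<mu> g \<le> b / ((1 + real (len g)) powr D * l (1 + (real (len g))\<^sup>2))"
  shows "\<exists>M>0. tails_le \<mu> M"
proof -
  obtain B where B: "B > 0" "\<And>k. real (card (dyad k)) \<le> B * Q ^ k"
    using volume_bounds by auto
  define M where "M = b * B * Q"
  have M: "0 < M" using b B Q_pos by (simp add: M_def)
  have shell: "measure_pmf.prob \<mu> {g \<in> carrier G. 2 ^ j \<le> len g \<and> len g < 2 ^ Suc j} \<le> M * lam j" for j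
  proof -
    let ?X = "{g \<in> carrier G. 2 ^ j \<le> len g \<and> len g < 2 ^ Suc j}"
    have sub: "?X \<subseteq> dyad (Suc j)" by (auto simp: dyad_def ball_def)
    have fin: "finite (dyad (Suc j))" by (simp add: dyad_def finite_ball)
    have "measure_pmf.prob \<mu> ?X = (\<Sum>g\<in>?X. pmf \<mu> g)"
      using finite_subset[OF sub fin] by (rule measure_measure_pmf_finite)
    also have "\<dots> \<le> (\<Sum>g\<in>?X. b / Q ^ j * lam j)"
    proof (rule sum_mono)
      fix g assume g: "g \<in> ?X"
      then have leng: "2 ^ j \<le> real (len g)"
        by (metis (mono_tags, lifting) mem_Collect_eq of_nat_le_iff of_nat_numeral of_nat_power)
      have "4 ^ j = ((2::real) ^ j)\<^sup>2"
        by (simp add: power_mult[symmetric] mult.commute[of j]) (simp add: power_mult)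
      also have "\<dots> \<le> (real (len g))\<^sup>2" using leng by (intro power_mono) auto
      finally have leng2: "4 ^ j \<le> 1 + (real (len g))\<^sup>2" by simp
      have leng1: "2 ^ j \<le> 1 + real (len g)" using leng by linarith
      have "pmf \<mu> g \<le> b / ((1 + real (len g)) powr D * l (1 + (real (len g))\<^sup>2))"
        using le g by simp
      also have "\<dots> \<le> b / ((2 ^ j) powr D * l (4 ^ j))"
        using leng1 leng2 b D_nonneg
        by (intro divide_left_mono mult_mono powr_mono2 l_le mult_pos_pos l_pos)
           (auto intro!: l_nonneg add_pos_nonneg)
      also have "\<dots> = b / Q ^ j * lam j" by (simp add: Q_power lam_def)
      finally show "pmf \<mu> g \<le> b / Q ^ j * lam j" .
    qed
    also have "\<dots> = real (card ?X) * (b / Q ^ j * lam j)" by simp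
    also have "\<dots> \<le> (B * Q ^ Suc j) * (b / Q ^ j * lam j)"
      using card_mono[OF fin sub] B(2)[of "Suc j"] b Q_pos lam_nonneg[of j]
      by (intro mult_right_mono) auto
    also have "\<dots> = M * lam j" using Q_pos by (simp add: M_def)
    finally show ?thesis .
  qed
  have "measure_pmf.prob \<mu> {g \<in> carrier G. 2 ^ k \<le> len g} \<le> M * tail k" for k
  proof -
    let ?X = "\<lambda>j. {g \<in> carrier G. 2 ^ (k + j) \<le> len g \<and> len g < 2 ^ Suc (k + j)}"
    have "{g \<in> carrier G. 2 ^ k \<le> len g} \<subseteq> (\<Union>j. ?X j)"
    proof
      fix g assume g: "g \<in> {g \<in> carrier G. 2 ^ k \<le> len g}"
      then have "2 ^ k \<le> len g" by simp
      then have "1 \<le> len g" by (rule order_trans[rotated]) simp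
      then obtain i where i: "2 ^ i \<le> len g" "len g < 2 ^ (i + 1)"
        using ex_power_ivl1[of 2 "len g"] by auto
      have "(2::nat) ^ k < 2 ^ (i + 1)" using g i by auto
      then have "k < i + 1" by (rule power_less_imp_less_exp[rotated]) simp
      then have "k \<le> i" by simp
      then have "g \<in> ?X (i - k)" using g i by simp
      then show "g \<in> (\<Union>j. ?X j)" by blast
    qed
    then have "emeasure (measure_pmf \<mu>) {g \<in> carrier G. 2 ^ k \<le> len g} \<le> emeasure (measure_pmf \<mu>) (\<Union>j. ?X j)"
      by (intro emeasure_mono) auto
    also have "\<dots> \<le> (\<Sum>j. emeasure (measure_pmf \<mu>) (?X j))"
      by (intro emeasure_subadditive_countably) auto
    also have "\<dots> \<le> (\<Sum>j. ennreal (M * lam (k + j)))"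
      using shell by (intro suminf_le) (auto simp: measure_pmf.emeasure_eq_measure intro!: ennreal_leI)
    also have "\<dots> = ennreal (M * tail k)"
      unfolding tail_def using M lam_nonneg summable_lam_shift
      by (subst suminf_ennreal2) (auto intro!: summable_mult mult_nonneg_nonneg simp: suminf_mult)
    finally show ?thesis
      using M tail_pos[of k] by (simp add: measure_pmf.emeasure_eq_measure)
  qed
  then show ?thesis using M by (auto simp: tails_le_def)
qed

lemma tails_le_lazy:
  assumes "0 \<le> p" "p \<le> 1" "tails_le \<mu> M"
  shows "tails_le (lazy p \<mu>) (p * M)"
  unfolding tails_le_def
proof
  fix k
  have "measure_pmf.prob (lazy p \<mu>) {g \<in> carrier G. 2 ^ k \<le> len g}
      = p * measure_pmf.prob \<mu> {g \<in> carrier G. 2 ^ k \<le> len g}"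
    using assms by (intro prob_lazy) (auto simp: word_length_one)
  also have "\<dots> \<le> p * (M * tail k)"
    using assms by (intro mult_left_mono) (auto simp: tails_le_def)
  finally show "measure_pmf.prob (lazy p \<mu>) {g \<in> carrier G. 2 ^ k \<le> len g} \<le> p * M * tail k"
    by (simp add: mult.assoc)
qed

section \<open>The infimum over the weak class against the given walk\<close>

text \<open>In one direction \<open>\<phi>\<close> is compared with every \<open>\<psi>\<close> in
  the class with uniform constants, and the infimum is taken. In the other the infimum is at most
  its value at a lazy version \<open>\<mu>\<close> of \<open>\<phi>\<close>, which is compared back
  with \<open>\<phi>\<close>.\<close>

lemma weak_Phi_sim:
  assumes \<phi>: "prob_on G \<phi>" "symmetric_on G \<phi>"
    and ab: "0 < a" "0 < b"
    and lo: "jump_ge \<phi> a"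
    and up: "\<And>g. g \<in> carrier G \<Longrightarrow> pmf \<phi> g \<le> b / ((1 + real (len g)) powr D * l (1 + (real (len g))\<^sup>2))"
  shows "sim_nat (weak_Phi G S (theta2 l)) (\<lambda>n. pmf (conv_power G \<phi> n) \<one>)"
proof -
  let ?W = "weak_class G S (theta2 l)"
  let ?R = "\<lambda>\<psi> n. pmf (conv_power G \<psi> n) \<one>"
  obtain M where M: "0 < M" "tails_le \<phi> M" using jump_le_tails_le[OF ab(2) up] by blast
  obtain \<delta> where \<delta>: "0 < \<delta>"
    "\<And>\<psi>. prob_on G \<psi> \<Longrightarrow> symmetric_on G \<psi> \<Longrightarrow> tails_le \<psi> \<delta> \<Longrightarrow> \<psi> \<in> ?W"
    using tails_le_weak_class by blast
  \<comment> \<open>Enough laziness to bring the tail constant from \<open>M\<close> down to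
    \<open>\<delta>\<close>.\<close>
  define p where "p = min 1 (\<delta> / M)"
  have p: "0 < p" "p \<le> 1" "p * M \<le> \<delta>"
    using \<delta>(1) M(1) by (auto simp: p_def min_def field_simps)
  define \<mu> where "\<mu> = lazy p \<phi>"
  have \<mu>: "prob_on G \<mu>" using \<phi> by (simp add: \<mu>_def prob_on_lazy)
  have \<mu>W: "\<mu> \<in> ?W"
  proof (rule \<delta>(2)[OF \<mu>])
    show "symmetric_on G \<mu>" using p \<phi> by (simp add: \<mu>_def symmetric_on_lazy)
    have "tails_le \<mu> (p * M)" unfolding \<mu>_def using p M by (intro tails_le_lazy) auto
    then show "tails_le \<mu> \<delta>"
      unfolding tails_le_def using p(3) tail_pos by (meson mult_right_mono less_imp_le order_trans)
  qed
  have \<mu>_ge: "jump_ge \<mu> (p * a)"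
    unfolding jump_ge_def
  proof
    fix g assume g: "g \<in> carrier G"
    let ?d = "(1 + real (len g)) powr D * l (1 + (real (len g))\<^sup>2)"
    have "p * a / ?d = p * (a / ?d)" by simp
    also have "\<dots> \<le> p * pmf \<phi> g" using lo g p by (intro mult_left_mono) (auto simp: jump_ge_def)
    also have "\<dots> \<le> pmf \<mu> g" using p by (simp add: \<mu>_def pmf_lazy)
    finally show "p * a / ?d \<le> pmf \<mu> g" .
  qed
  have bdd: "bdd_below ((\<lambda>\<psi>. ?R \<psi> (2 * n)) ` ?W)" for n
    by (rule bdd_belowI[where m = 0]) auto
  obtain c C where c: "0 < c" "0 < C" and upper: "\<And>\<psi> n. prob_on G \<psi> \<Longrightarrow> symmetric_on G \<psi> \<Longrightarrow>
      tails_le \<psi> 24 \<Longrightarrow> ?R \<phi> n \<le> C * ?R \<psi> (2 * nat \<lfloor>c * real n\<rfloor>)"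
    using return_prob_compare[OF \<phi>(1) lo ab(1), of 24] by auto
  obtain c' C' where c': "0 < c'" "0 < C'" and lower: "\<And>n. ?R \<mu> n \<le> C' * ?R \<phi> (2 * nat \<lfloor>c' * real n\<rfloor>)"
    using return_prob_compare[OF \<mu> \<mu>_ge _ M(1)] ab p \<phi> M(2) by (metis mult_pos_pos)
  \<comment> \<open>At odd times \<open>n\<close> the return probability is reached from time
    \<open>n - 1\<close> at the cost of this factor.\<close>
  have e: "0 < pmf \<phi> \<one>"
  proof -
    have "a / ((1 + real (len \<one>)) powr D * l (1 + (real (len \<one>))\<^sup>2)) \<le> pmf \<phi> \<one>"
      using lo by (simp add: jump_ge_def)
    moreover have "0 < a / ((1 + real (len \<one>)) powr D * l (1 + (real (len \<one>))\<^sup>2))"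
      using ab l_pos[of 1] by (simp add: word_length_one)
    ultimately show ?thesis by linarith
  qed
  have "?R \<phi> n \<le> C * weak_Phi G S (theta2 l) (nat \<lfloor>c * real n\<rfloor>)" for n
  proof -
    have "?R \<phi> n / C \<le> weak_Phi G S (theta2 l) (nat \<lfloor>c * real n\<rfloor>)"
      unfolding weak_Phi_def
    proof (rule cINF_greatest)
      fix \<psi> assume "\<psi> \<in> ?W"
      then show "?R \<phi> n / C \<le> ?R \<psi> (2 * nat \<lfloor>c * real n\<rfloor>)"
        using upper[of \<psi> n] weak_class_tails_le[of \<psi>] c by (simp add: weak_class_def field_simps)
    qed (use \<mu>W in auto)
    then show ?thesis using c by (simp add: field_simps)
  qed
  moreover have "pmf \<phi> \<one> / C' * weak_Phi G S (theta2 l) (nat \<lceil>1 / c' * real n\<rceil>) \<le> ?R \<phi> n" for n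
  proof -
    \<comment> \<open>Rounding up ensures \<open>n \<le> c' * m\<close>, so the even time
      \<open>N\<close> that corresponds to \<open>2 * m\<close> steps of \<open>\<mu>\<close> is at
      least the even part of \<open>n\<close>.\<close>
    define m where "m = nat \<lceil>1 / c' * real n\<rceil>"
    have "1 / c' * real n \<le> real m" unfolding m_def by (rule real_nat_ceiling_ge)
    then have m: "real n \<le> c' * real m" using c' by (simp add: field_simps)
    define N where "N = 2 * nat \<lfloor>c' * real (2 * m)\<rfloor>"
    have "n \<le> nat \<lfloor>c' * real (2 * m)\<rfloor>"
      using m by (simp add: le_nat_floor)
    then have N: "2 * (n div 2) \<le> N" by (simp add: N_def)
    have "weak_Phi G S (theta2 l) m \<le> ?R \<mu> (2 * m)"
      unfolding weak_Phi_def using bdd \<mu>W by (rule cINF_lower)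
    also have "\<dots> \<le> C' * ?R \<phi> N" unfolding N_def by (rule lower)
    also have "\<dots> \<le> C' * ?R \<phi> (2 * (n div 2))"
      using c' N by (intro mult_left_mono return_prob_mono \<phi>) auto
    finally have "pmf \<phi> \<one> / C' * weak_Phi G S (theta2 l) m \<le> pmf \<phi> \<one> / C' * (C' * ?R \<phi> (2 * (n div 2)))"
      using e c' by (intro mult_left_mono) auto
    also have "\<dots> = ?R \<phi> (2 * (n div 2)) * pmf \<phi> \<one>" using c' by simp
    also have "\<dots> \<le> ?R \<phi> n"
    proof (cases "even n")
      case True
      then show ?thesis by (simp add: mult_left_le pmf_le_1)
    next
      case False
      then have "Suc (2 * (n div 2)) = n" by presburger
      then show ?thesis using return_prob_Suc_ge[OF \<phi>(1), of "2 * (n div 2)"] by simp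
    qed
    finally show ?thesis unfolding m_def .
  qed
  ultimately show ?thesis
    unfolding sim_nat_def using e c c'
    by (intro exI[of _ "pmf \<phi> \<one> / C'"] exI[of _ "1 / c'"] exI[of _ C] exI[of _ c]) auto
qed

end

theorem theorem5p1:
  fixes G (structure) and S :: "'a list" and D :: real
    and l :: "real \<Rightarrow> real" and \<phi> :: "'a pmf"
  assumes "group G"
    and "gen_tuple G S"
    and "poly_growth G S D"
    and "\<forall>t\<ge>0. l t > 0"
    and "continuous_on {0..} l"
    and "mono_on {0..} l"
    and "slowly_varying l"
    and "set_integrable lborel {1..} (\<lambda>t. 1 / (t * l t))"
    and "prob_on G \<phi>"
    and "symmetric_on G \<phi>"
    and "\<exists>a>0. \<exists>b>0. \<forall>g\<in>carrier G.
           a * (1 / ((1 + real (word_length G S g)) powr D * l (1 + (real (word_length G S g))\<^sup>2))) \<le> pmf \<phi> g \<and>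
           pmf \<phi> g \<le> b * (1 / ((1 + real (word_length G S g)) powr D * l (1 + (real (word_length G S g))\<^sup>2)))"
  shows "sim_nat (weak_Phi G S (theta2 l)) (\<lambda>n. pmf (conv_power G \<phi> n) \<one>)"
proof -
  interpret group G by fact
  interpret growth_setup G S l D
    using assms by unfold_locales auto
  obtain a b where ab: "0 < a" "0 < b"
    "jump_ge \<phi> a"
    "\<And>g. g \<in> carrier G \<Longrightarrow> pmf \<phi> g \<le> b / ((1 + real (len g)) powr D * l (1 + (real (len g))\<^sup>2))"
    using assms(11) by (auto simp: jump_ge_def)
  show ?thesis
    using assms(9,10) ab by (rule weak_Phi_sim)
qed

end
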